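(* Let $\mathbf{B}\subset\mathbb{R}^n$ be a compact box and let $\mu$ be a finite Borel measure on $\mathbb{R}^n$ with support $\mathbf{B}$ having density $q(\mathbf{x})\exp(r(\mathbf{x}))1_{\mathbf{B}}(\mathbf{x})$ with respect to Lebesgue measure, for some polynomials $q,r\in\mathbb{R}[\mathbf{x}]$. Let $z_\alpha=\int\mathbf{x}^\alpha\,d\mu(\mathbf{x})$, $\alpha\in\mathbb{N}^n$, and $\mathbf{z}=(z_\alpha)_{\alpha\in\mathbb{N}^n}$. For $i=1,\ldots,p$ let $\mathbf{\Omega}_i=\{\mathbf{x}\in\mathbb{R}^n : g_{ij}(\mathbf{x})\ge 0,\ j=1,\ldots,m_i\}$ with $g_{ij}\in\mathbb{R}[\mathbf{x}]$, such that $\mathbf{\Omega}:=\bigcup_{i=1}^p\mathbf{\Omega}_i\subset\mathbf{B}$, and assume that $\mathbf{\Omega}$ is the closure of its interior. Put $r_{ij}=\lceil\deg(g_{ij})/2\rceil$, $d_0=\max_{i,j}r_{ij}$, $g=\prod_{i=1}^p\prod_{j=1}^{m_i}g_{ij}$, and for $\alpha\in\mathbb{N}^n$ and $k=1,\ldots,n$, $$p_{\alpha,k}(\mathbf{x})=q(\mathbf{x})\frac{\partial}{\partial x_k}\big(\mathbf{x}^\alpha g(\mathbf{x})\big)+2\,\mathbf{x}^\alpha g(\mathbf{x})\frac{\partial q}{\partial x_k}(\mathbf{x})+\mathbf{x}^\alpha g(\mathbf{x})q(\mathbf{x})\frac{\partial r}{\partial x_k}(\mathbf{x}).$$ For every integer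 $d\ge d_0$ let $\mathbf{Q}_d^{\mathrm{Stokes}}$ be the semidefinite program $$\begin{aligned}\rho_d^{\mathrm{Stokes}}=\sup_{\mathbf{y}^1,\ldots,\mathbf{y}^p}\Big\{\sum_{i=1}^p y^i_0\ :\ &\mathbf{M}_d\Big(\mathbf{z}-\sum_{i=1}^p\mathbf{y}^i\Big)\succeq0;\ \mathbf{M}_d(\mathbf{y}^i)\succeq0,\ i=1,\ldots,p;\\ &\mathbf{M}_{d-r_{ij}}(g_{ij}\,\mathbf{y}^i)\succeq0,\ j=1,\ldots,m_i,\ i=1,\ldots,p;\\ &L_{\mathbf{y}^i}(p_{\alpha,k})=0,\ k=1,\ldots,n,\ |\alpha|\le 2d-\deg(p_{\alpha,k}),\ i=1,\ldots,p\Big\},\end{aligned}$$ where each $\mathbf{y}^i=(y^i_\alpha)_{\alpha\in\mathbb{N}^n_{2d}}$ is a real sequence. Then: (i) For every $d\ge d_0$, $\mathbf{Q}_d^{\mathrm{Stokes}}$ has an optimal solution, and the sequence of optimal values $(\rho_d^{\mathrm{Stokes}})_{d\ge d_0}$ is monotone nonincreasing and converges to $\mu(\mathbf{\Omega})$, that is, $\rho_d^{\mathrm{Stokes}}\downarrow\mu(\mathbf{\Omega})$ as $d\to\infty$. (ii) For each $d\ge d_0$ let $(\mathbf{y}^{1,d},\ldots,\mathbf{y}^{p,d})$ be an optimal solution of $\mathbf{Q}_d^{\mathrm{Stokes}}$. Then for each $\alpha\in\mathbb{N}^n$, $$\lim_{d\to\infty}\sum_{i=1}^p y_\alpha^{i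,d}=\int_{\mathbf{\Omega}}\mathbf{x}^\alpha\,d\mu.$$
   Context: A box is a product of $n$ compact intervals of positive length. $\mathbb{N}$ includes $0$; $\mathbb{N}^n_d=\{\gamma\in\mathbb{N}^n:|\gamma|\le d\}$ with $|\gamma|=\sum_i\gamma_i$. $1_{\mathbf{B}}$ is the indicator function of $\mathbf{B}$. For a real sequence $\mathbf{y}=(y_\gamma)$ indexed by $\mathbb{N}^n_{2d}$, the Riesz functional is $L_{\mathbf{y}}(h)=\sum_\gamma h_\gamma y_\gamma$ for $h=\sum_\gamma h_\gamma\mathbf{x}^\gamma$ of degree at most $2d$. The moment matrix $\mathbf{M}_d(\mathbf{y})$ is the real symmetric matrix with rows and columns indexed by $\mathbb{N}^n_d$ and entries $\mathbf{M}_d(\mathbf{y})(\alpha,\beta)=y_{\alpha+\beta}$. For $g=\sum_\gamma g_\gamma\mathbf{x}^\gamma\in\mathbb{R}[\mathbf{x}]$, the localizing matrix $\mathbf{M}_d(g\,\mathbf{y})$ is indexed by $\mathbb{N}^n_d$ and has entries $\mathbf{M}_d(g\,\mathbf{y})(\alpha,\beta)=L_{\mathbf{y}}(g\,\mathbf{x}^{\alpha+\beta})=\sum_\gamma g_\gamma y_{\alpha+\beta+\gamma}$. $\mathbf{A}\succeq0$ means that $\mathbf{A}$ is positive semidefinite. In $\mathbf{z}-\sum_i\mathbf{y}^i$ the sequence $\mathbf{z}$ is truncated to indices in $\mathbb{N}^n_{2d}$. If $p_{\alpha,k}$ is the zero polynomial the corresponding linear constraint is void. *)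

theory Defs
  imports "HOL-Analysis.Analysis" "HOL-Library.Poly_Mapping"
begin

section \<open>Polynomials in the variables x $ i\<close>

text \<open>
  A polynomial in \<open>CARD('n)\<close> variables is the finitely supported map from exponents
  to coefficients, with the ring structure (convolution product) of
  \<^theory>\<open>HOL-Library.Poly_Mapping\<close>.
\<close>

type_synonym 'n expo = "'n \<Rightarrow>\<^sub>0 nat"
type_synonym 'n mpoly = "'n expo \<Rightarrow>\<^sub>0 real"

definition expo_size :: "'n::finite expo \<Rightarrow> nat"
  where "expo_size \<gamma> = (\<Sum>i\<in>UNIV. Poly_Mapping.lookup \<gamma> i)"

definition expos :: "nat \<Rightarrow> 'n::finite expo set"
  where "expos d = {\<gamma>. expo_size \<gamma> \<le> d}"

definition monom_fun :: "'n::finite expo \<Rightarrow> real ^ 'n \<Rightarrow> real"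
  where "monom_fun \<gamma> x = (\<Prod>i\<in>UNIV. (x $ i) ^ Poly_Mapping.lookup \<gamma> i)"

definition monomial :: "'n expo \<Rightarrow> 'n mpoly"
  where "monomial \<gamma> = Poly_Mapping.single \<gamma> 1"

definition mp_eval :: "'n::finite mpoly \<Rightarrow> real ^ 'n \<Rightarrow> real"
  where "mp_eval f x = (\<Sum>\<gamma>\<in>Poly_Mapping.keys f. Poly_Mapping.lookup f \<gamma> * monom_fun \<gamma> x)"

text \<open>Total degree, with the convention that the zero polynomial has degree 0.\<close>

definition mp_degree :: "'n::finite mpoly \<Rightarrow> nat"
  where "mp_degree f = Max (insert 0 (expo_size ` Poly_Mapping.keys f))"

text \<open>
  Formal partial derivative.  The exponent subtraction is truncated, but only where
  \<open>Poly_Mapping.lookup \<gamma> k = 0\<close>, in which case the coefficient vanishes.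
\<close>

definition mp_deriv :: "'n \<Rightarrow> 'n mpoly \<Rightarrow> 'n mpoly"
  where "mp_deriv k f = (\<Sum>\<gamma>\<in>Poly_Mapping.keys f.
    Poly_Mapping.single (\<gamma> - Poly_Mapping.single k 1)
      (real (Poly_Mapping.lookup \<gamma> k) * Poly_Mapping.lookup f \<gamma>))"

section \<open>Measures\<close>

definition measure_support :: "'a::topological_space measure \<Rightarrow> 'a set"
  where "measure_support M = {x. \<forall>U. open U \<and> x \<in> U \<longrightarrow> emeasure M U > 0}"

definition is_box :: "(real ^ 'n::finite) set \<Rightarrow> bool"
  where "is_box B \<longleftrightarrow> (\<exists>a b. (\<forall>i. a $ i < b $ i) \<and> B = cbox a b)"

definition moment :: "(real ^ 'n::finite) measure \<Rightarrow> 'n expo \<Rightarrow> real"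
  where "moment M \<alpha> = (LINT x|M. monom_fun \<alpha> x)"

section \<open>Moment and localizing matrices\<close>

definition riesz :: "('n::finite expo \<Rightarrow> real) \<Rightarrow> 'n mpoly \<Rightarrow> real"
  where "riesz y h = (\<Sum>\<gamma>\<in>Poly_Mapping.keys h. Poly_Mapping.lookup h \<gamma> * y \<gamma>)"

text \<open>
  Matrices with rows and columns indexed by a finite set \<open>I\<close> are binary functions, of which
  only the values on \<open>I \<times> I\<close> matter.
\<close>

definition psd_on :: "'a set \<Rightarrow> ('a \<Rightarrow> 'a \<Rightarrow> real) \<Rightarrow> bool"
  where "psd_on I A \<longleftrightarrow> (\<forall>\<alpha>\<in>I. \<forall>\<beta>\<in>I. A \<alpha> \<beta> = A \<beta> \<alpha>) \<and>
    (\<forall>v. 0 \<le> (\<Sum>\<alpha>\<in>I. \<Sum>\<beta>\<in>I. v \<alpha> * A \<alpha> \<beta> * v \<beta>))"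

definition moment_matrix :: "('n::finite expo \<Rightarrow> real) \<Rightarrow> 'n expo \<Rightarrow> 'n expo \<Rightarrow> real"
  where "moment_matrix y \<alpha> \<beta> = y (\<alpha> + \<beta>)"

definition localizing_matrix ::
    "'n::finite mpoly \<Rightarrow> ('n expo \<Rightarrow> real) \<Rightarrow> 'n expo \<Rightarrow> 'n expo \<Rightarrow> real"
  where "localizing_matrix g y \<alpha> \<beta> = riesz y (g * monomial (\<alpha> + \<beta>))"

section \<open>The semidefinite programs\<close>

text \<open>
  The sets \<open>\<Omega>\<^sub>i\<close> are described by polynomials \<open>g i j\<close> with \<open>i \<in> {1..p}\<close> and \<open>j \<in> {1..m i}\<close>.
\<close>

definition basic_set :: "(nat \<Rightarrow> nat) \<Rightarrow> (nat \<Rightarrow> nat \<Rightarrow> 'n::finite mpoly) \<Rightarrow> nat \<Rightarrow> (real ^ 'n) set"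
  where "basic_set m g i = {x. \<forall>j\<in>{1..m i}. 0 \<le> mp_eval (g i j) x}"

definition half_degree :: "'n::finite mpoly \<Rightarrow> nat"
  where "half_degree f = nat \<lceil>real (mp_degree f) / 2\<rceil>"

definition min_order :: "nat \<Rightarrow> (nat \<Rightarrow> nat) \<Rightarrow> (nat \<Rightarrow> nat \<Rightarrow> 'n::finite mpoly) \<Rightarrow> nat"
  where "min_order p m g = Max {half_degree (g i j) | i j. i \<in> {1..p} \<and> j \<in> {1..m i}}"

definition prod_all :: "nat \<Rightarrow> (nat \<Rightarrow> nat) \<Rightarrow> (nat \<Rightarrow> nat \<Rightarrow> 'n::finite mpoly) \<Rightarrow> 'n mpoly"
  where "prod_all p m g = (\<Prod>i\<in>{1..p}. \<Prod>j\<in>{1..m i}. g i j)"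

text \<open>
  For a density \<open>q exp r\<close> on a box, \<open>stokes_poly q r h \<alpha> k\<close> times \<open>q exp r\<close> is the
  partial derivative with respect to \<open>x $ k\<close> of \<open>x\<^sup>\<alpha> h q\<^sup>2 exp r\<close>.
\<close>

definition stokes_poly ::
    "'n::finite mpoly \<Rightarrow> 'n mpoly \<Rightarrow> 'n mpoly \<Rightarrow> 'n expo \<Rightarrow> 'n \<Rightarrow> 'n mpoly"
  where "stokes_poly q r h \<alpha> k =
    q * mp_deriv k (monomial \<alpha> * h) + 2 * monomial \<alpha> * h * mp_deriv k q
      + monomial \<alpha> * h * q * mp_deriv k r"

text \<open>
  A point is a tuple of \<open>p\<close> sequences indexed by \<open>expos (2 * d)\<close>, encoded by extensional
  functions.  No constraint refers to an entry outside that index set when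
  \<open>min_order p m g \<le> d\<close>.  The bound \<open>|\<alpha>| \<le> 2d - deg p\<close> of the Stokes constraints is written
  additively because subtraction on natural numbers truncates.
\<close>

definition stokes_feasible ::
    "nat \<Rightarrow> (nat \<Rightarrow> nat) \<Rightarrow> (nat \<Rightarrow> nat \<Rightarrow> 'n::finite mpoly) \<Rightarrow> 'n mpoly \<Rightarrow> 'n mpoly
      \<Rightarrow> ('n expo \<Rightarrow> real) \<Rightarrow> nat \<Rightarrow> (nat \<Rightarrow> 'n expo \<Rightarrow> real) set"
  where "stokes_feasible p m g q r z d =
    {y \<in> {1..p} \<rightarrow>\<^sub>E (expos (2 * d) \<rightarrow>\<^sub>E UNIV).
      psd_on (expos d) (moment_matrix (\<lambda>\<gamma>. z \<gamma> - (\<Sum>i\<in>{1..p}. y i \<gamma>))) \<and>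
      (\<forall>i\<in>{1..p}. psd_on (expos d) (moment_matrix (y i))) \<and>
      (\<forall>i\<in>{1..p}. \<forall>j\<in>{1..m i}.
         psd_on (expos (d - half_degree (g i j))) (localizing_matrix (g i j) (y i))) \<and>
      (\<forall>i\<in>{1..p}. \<forall>k \<alpha>.
         expo_size \<alpha> + mp_degree (stokes_poly q r (prod_all p m g) \<alpha> k) \<le> 2 * d \<longrightarrow>
         riesz (y i) (stokes_poly q r (prod_all p m g) \<alpha> k) = 0)}"

definition objective :: "nat \<Rightarrow> (nat \<Rightarrow> 'n::finite expo \<Rightarrow> real) \<Rightarrow> real"
  where "objective p y = (\<Sum>i\<in>{1..p}. y i 0)"

text \<open>The optimal value is an extended real, so that the supremum needs no side condition.\<close>

definition stokes_value ::
    "nat \<Rightarrow> (nat \<Rightarrow> nat) \<Rightarrow> (nat \<Rightarrow> nat \<Rightarrow> 'n::finite mpoly) \<Rightarrow> 'n mpoly \<Rightarrow> 'n mpoly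
      \<Rightarrow> ('n expo \<Rightarrow> real) \<Rightarrow> nat \<Rightarrow> ereal"
  where "stokes_value p m g q r z d = (SUP y\<in>stokes_feasible p m g q r z d. ereal (objective p y))"

definition stokes_optimal ::
    "nat \<Rightarrow> (nat \<Rightarrow> nat) \<Rightarrow> (nat \<Rightarrow> nat \<Rightarrow> 'n::finite mpoly) \<Rightarrow> 'n mpoly \<Rightarrow> 'n mpoly
      \<Rightarrow> ('n expo \<Rightarrow> real) \<Rightarrow> nat \<Rightarrow> (nat \<Rightarrow> 'n expo \<Rightarrow> real) \<Rightarrow> bool"
  where "stokes_optimal p m g q r z d y \<longleftrightarrow> y \<in> stokes_feasible p m g q r z d \<and>
    ereal (objective p y) = stokes_value p m g q r z d"

end

theory Submission
  imports Defs "HOL-Complex_Analysis.Great_Picard"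
begin

text \<open>
  Split \<open>\<Omega>\<close> into disjoint pieces of the \<open>\<Omega>\<^sub>i\<close> and let \<open>y\<^sup>i\<close> be the moments of \<open>\<mu>\<close>
  restricted to the \<open>i\<close>-th piece.  The semidefinite constraints hold because they
  express integrals of nonnegative functions.  The Stokes constraints hold because
  \<open>p\<^sub>\<alpha>\<^sub>,\<^sub>k q exp r\<close> is the \<open>k\<close>-th partial derivative of \<open>x\<^sup>\<alpha> g q\<^sup>2 exp r\<close>, which vanishes on the boundary
  of each piece, as some \<open>g\<^sub>i\<^sub>j\<close> does; hence the derivative integrates to 0 over
  the piece (\<open>integral_deriv_eq_0_if_zero_on_frontier\<close>).  So the optimal values are at least \<open>\<mu>(\<Omega>)\<close>.  Feasible
  sequences are bounded entry by entry, uniformly in \<open>d\<close>, and the constraints are closed; this gives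
  optimal solutions at each order (\<open>stokes_optimal_exists\<close>).  Truncation maps feasible points of one
  order to those of a lower order, so the optimal values do not increase with the order.

  By the same compactness, each subsequence of optimal solutions has a further
  subsequence that converges entry by entry to sequences satisfying the constraints of every order
  (locale \<open>limit_tuple\<close>).  Let \<open>L\<^sub>i\<close> be their Riesz functionals.  From \<open>L\<^sub>i(f\<^sup>2) \<ge> 0\<close> and
  \<open>\<Sum>\<^sub>i L\<^sub>i(f\<^sup>2) \<le> \<integral> f\<^sup>2 d\<mu>\<close> it follows that \<open>L\<^sub>i\<close> is continuous for uniform convergence on the compact
  box \<open>B\<close>.  With the Weierstrass theorem, positivity extends from squares to all polynomials that are
  nonnegative on \<open>B\<close>: \<open>L\<^sub>i(f) \<ge> 0\<close>, \<open>L\<^sub>i(g\<^sub>i\<^sub>j f) \<ge> 0\<close> and \<open>\<Sum>\<^sub>i L\<^sub>i(f) \<le> \<integral> f d\<mu>\<close> for such \<open>f\<close>.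
  Approximating continuous functions by polynomials, one gets for every
  penalty \<open>N\<close> the bound \<open>\<Sum>\<^sub>i L\<^sub>i(f) \<le> \<integral> max 0 (f - N U) d\<mu>\<close>, where \<open>U\<close> is a continuous function that
  vanishes exactly on \<open>\<Omega>\<close> and is dominated for each \<open>i\<close> by the violation of the constraints of \<open>\<Omega>\<^sub>i\<close>
  (\<open>sum_riesz_le_penalized_integral\<close>).  As \<open>N\<close> tends to infinity, \<open>\<Sum>\<^sub>i L\<^sub>i(f) \<le> \<integral>\<^sub>\<Omega> max 0 f d\<mu>\<close>.  Since
  \<open>\<Sum>\<^sub>i L\<^sub>i(1) \<ge> \<mu>(\<Omega>)\<close>, adding constants to \<open>\<plusminus> f\<close> turns this into \<open>\<Sum>\<^sub>i L\<^sub>i(f) = \<integral>\<^sub>\<Omega> f d\<mu>\<close>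
  (\<open>sum_riesz_eq_integral_Omega\<close>).  The limit does not depend on the subsequence, so the moments
  converge, and for the exponent 0 this is the convergence of the optimal values.
\<close>

section \<open>Polynomials and Riesz functionals\<close>

lemma riesz_eq_sum:
  assumes "finite S" "Poly_Mapping.keys h \<subseteq> S"
  shows "riesz y h = (\<Sum>\<gamma>\<in>S. Poly_Mapping.lookup h \<gamma> * y \<gamma>)"
  unfolding riesz_def
  by (rule sum.mono_neutral_left) (use assms in \<open>auto simp: in_keys_iff\<close>)

lemma riesz_zero [simp]: "riesz y 0 = 0"
  by (simp add: riesz_def)

lemma riesz_single [simp]: "riesz y (Poly_Mapping.single \<gamma> c) = c * y \<gamma>"
  by (simp add: riesz_def)

lemma riesz_monomial [simp]: "riesz y (monomial \<gamma>) = y \<gamma>"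
  by (simp add: monomial_def)

lemma riesz_one [simp]: "riesz y 1 = y 0"
  by (simp add: riesz_def)

lemma riesz_add [simp]: "riesz y (f + h) = riesz y f + riesz y h"
proof -
  let ?S = "Poly_Mapping.keys f \<union> Poly_Mapping.keys h"
  have "riesz y (f + h) = (\<Sum>\<gamma>\<in>?S. Poly_Mapping.lookup (f + h) \<gamma> * y \<gamma>)"
    by (rule riesz_eq_sum) (use keys_add[of f h] in auto)
  also have "\<dots> = riesz y f + riesz y h"
    by (simp add: riesz_eq_sum[of ?S] lookup_add algebra_simps sum.distrib)
  finally show ?thesis .
qed

lemma riesz_uminus [simp]: "riesz y (- f) = - riesz y f"
  using riesz_add[of y f "- f"] by simp

lemma riesz_diff [simp]: "riesz y (f - h) = riesz y f - riesz y h"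
  using riesz_add[of y f "- h"] by simp

lemma riesz_sum [simp]: "riesz y (\<Sum>i\<in>I. f i) = (\<Sum>i\<in>I. riesz y (f i))"
  by (induction I rule: infinite_finite_induct) auto

lemma mpoly_eq_sum_single:
  fixes f :: "'n mpoly"
  shows "f = (\<Sum>\<gamma>\<in>Poly_Mapping.keys f. Poly_Mapping.single \<gamma> (Poly_Mapping.lookup f \<gamma>))"
  by (rule poly_mapping_eqI)
     (auto simp: lookup_sum lookup_single when_def sum.delta in_keys_iff)

lemma mpoly_mult_eq_sum_single:
  fixes f h :: "'n mpoly"
  shows "f * h = (\<Sum>\<alpha>\<in>Poly_Mapping.keys f. \<Sum>\<beta>\<in>Poly_Mapping.keys h.
     Poly_Mapping.single (\<alpha> + \<beta>) (Poly_Mapping.lookup f \<alpha> * Poly_Mapping.lookup h \<beta>))"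
proof -
  have "f * h = (\<Sum>\<alpha>\<in>Poly_Mapping.keys f. Poly_Mapping.single \<alpha> (Poly_Mapping.lookup f \<alpha>))
     * (\<Sum>\<beta>\<in>Poly_Mapping.keys h. Poly_Mapping.single \<beta> (Poly_Mapping.lookup h \<beta>))"
    by (intro arg_cong2[of _ _ _ _ "(*)"] mpoly_eq_sum_single)
  then show ?thesis
    by (simp add: sum_product mult_single)
qed

lemma riesz_const_mult [simp]: "riesz y (Poly_Mapping.single 0 c * f) = c * riesz y f"
proof -
  have "riesz y (Poly_Mapping.single 0 c * f)
      = riesz y (Poly_Mapping.single 0 c * (\<Sum>\<gamma>\<in>Poly_Mapping.keys f. Poly_Mapping.single \<gamma> (Poly_Mapping.lookup f \<gamma>)))"
    by (intro arg_cong[where f = "\<lambda>h. riesz y (_ * h)"] mpoly_eq_sum_single)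
  also have "\<dots> = c * riesz y f"
    by (simp add: sum_distrib_left mult_single riesz_def[of y f] mult.assoc)
  finally show ?thesis .
qed

lemma riesz_const_mult_right [simp]: "riesz y (f * Poly_Mapping.single 0 c) = c * riesz y f"
  by (subst mult.commute) (rule riesz_const_mult)

lemma riesz_numeral_mult [simp]: "riesz y (numeral N * f) = numeral N * riesz y f"
  by (simp flip: single_numeral)

lemma riesz_minus_sum:
  "riesz (\<lambda>\<gamma>. z \<gamma> - (\<Sum>i\<in>I. y i \<gamma>)) f = riesz z f - (\<Sum>i\<in>I. riesz (y i) f)"
proof -
  have "(\<Sum>i\<in>I. riesz (y i) f)
     = (\<Sum>\<gamma>\<in>Poly_Mapping.keys f. Poly_Mapping.lookup f \<gamma> * (\<Sum>i\<in>I. y i \<gamma>))"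
    unfolding riesz_def by (subst sum.swap) (simp add: sum_distrib_left)
  then show ?thesis
    by (simp add: riesz_def algebra_simps sum_subtractf)
qed

lemma tendsto_riesz:
  assumes "\<And>\<gamma>. \<gamma> \<in> Poly_Mapping.keys f \<Longrightarrow> ((\<lambda>t. y t \<gamma>) \<longlongrightarrow> y' \<gamma>) F"
  shows "((\<lambda>t. riesz (y t) f) \<longlongrightarrow> riesz y' f) F"
  unfolding riesz_def by (intro tendsto_sum tendsto_mult tendsto_const assms)

text \<open>
  Evaluation at \<open>x\<close> is the Riesz functional of the moments of the point mass at \<open>x\<close>, so it
  inherits linearity.
\<close>

lemma mp_eval_eq_riesz: "mp_eval f x = riesz (\<lambda>\<gamma>. monom_fun \<gamma> x) f"
  by (simp add: mp_eval_def riesz_def)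

lemma monom_fun_add: "monom_fun (\<alpha> + \<beta>) x = monom_fun \<alpha> x * monom_fun \<beta> x"
  by (simp add: monom_fun_def lookup_add power_add prod.distrib)

lemma monom_fun_zero [simp]: "monom_fun 0 x = 1"
  by (simp add: monom_fun_def)

lemma mp_eval_add [simp]: "mp_eval (f + h) x = mp_eval f x + mp_eval h x"
  and mp_eval_diff [simp]: "mp_eval (f - h) x = mp_eval f x - mp_eval h x"
  and mp_eval_uminus [simp]: "mp_eval (- f) x = - mp_eval f x"
  and mp_eval_zero [simp]: "mp_eval 0 x = 0"
  and mp_eval_one [simp]: "mp_eval 1 x = 1"
  and mp_eval_sum [simp]: "mp_eval (\<Sum>i\<in>I. F i) x = (\<Sum>i\<in>I. mp_eval (F i) x)"
  and mp_eval_monomial [simp]: "mp_eval (monomial \<gamma>) x = monom_fun \<gamma> x"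
  and mp_eval_const [simp]: "mp_eval (Poly_Mapping.single 0 c) x = c"
  and mp_eval_numeral [simp]: "mp_eval (numeral N) x = numeral N"
  by (simp_all add: mp_eval_eq_riesz flip: single_numeral)

lemma mp_eval_mult [simp]: "mp_eval (f * h) x = mp_eval f x * mp_eval h x"
proof -
  have "mp_eval (f * h) x = (\<Sum>\<alpha>\<in>Poly_Mapping.keys f. \<Sum>\<beta>\<in>Poly_Mapping.keys h.
     Poly_Mapping.lookup f \<alpha> * Poly_Mapping.lookup h \<beta> * (monom_fun \<alpha> x * monom_fun \<beta> x))"
    by (subst mpoly_mult_eq_sum_single) (simp add: mp_eval_eq_riesz monom_fun_add)
  also have "\<dots> = mp_eval f x * mp_eval h x"
    by (simp add: mp_eval_def sum_product algebra_simps)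
  finally show ?thesis .
qed

lemma mp_eval_prod [simp]: "mp_eval (\<Prod>i\<in>I. F i) x = (\<Prod>i\<in>I. mp_eval (F i) x)"
  by (induction I rule: infinite_finite_induct) auto

lemma continuous_on_mp_eval [continuous_intros]: "continuous_on S (mp_eval f)"
  unfolding mp_eval_def monom_fun_def by (intro continuous_intros)

lemma borel_measurable_mp_eval [measurable]: "mp_eval f \<in> borel_measurable borel"
  by (intro borel_measurable_continuous_onI continuous_intros)

lemma monom_fun_has_derivative_axis:
  fixes x :: "real ^ 'n::finite"
  shows "((\<lambda>t. monom_fun \<gamma> (x + t *\<^sub>R axis k 1)) has_real_derivative
    real (Poly_Mapping.lookup \<gamma> k) * monom_fun (\<gamma> - Poly_Mapping.single k 1) x) (at 0)"
proof -
  let ?e = "Poly_Mapping.lookup \<gamma>"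
  let ?P = "\<Prod>i\<in>UNIV - {k}. (x $ i) ^ ?e i"
  have split: "(\<Prod>i\<in>UNIV. f i) = f k * (\<Prod>i\<in>UNIV - {k}. f i)" for f :: "'n \<Rightarrow> real"
    by (rule prod.remove) auto
  have 1: "monom_fun \<gamma> (x + t *\<^sub>R axis k 1) = (x $ k + t) ^ ?e k * ?P" for t
    unfolding monom_fun_def by (subst split) (auto simp: axis_def intro!: prod.cong)
  have 2: "monom_fun (\<gamma> - Poly_Mapping.single k 1) x = (x $ k) ^ (?e k - 1) * ?P"
    unfolding monom_fun_def
    by (subst split) (auto simp: lookup_minus lookup_single when_def intro!: prod.cong)
  have "((\<lambda>t. (x $ k + t) ^ ?e k * ?P) has_real_derivative
      real (?e k) * (x $ k) ^ (?e k - 1) * ?P) (at 0)"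
    by (auto intro!: derivative_eq_intros)
  then show ?thesis
    unfolding 1 2 by (simp add: mult.assoc)
qed

lemma mp_eval_has_derivative_axis:
  "((\<lambda>t. mp_eval f (x + t *\<^sub>R axis k 1)) has_real_derivative mp_eval (mp_deriv k f) x) (at 0)"
proof -
  have "((\<lambda>t. \<Sum>\<gamma>\<in>Poly_Mapping.keys f. Poly_Mapping.lookup f \<gamma> * monom_fun \<gamma> (x + t *\<^sub>R axis k 1))
    has_real_derivative (\<Sum>\<gamma>\<in>Poly_Mapping.keys f. Poly_Mapping.lookup f \<gamma> *
       (real (Poly_Mapping.lookup \<gamma> k) * monom_fun (\<gamma> - Poly_Mapping.single k 1) x))) (at 0)"
    by (intro DERIV_sum DERIV_cmult monom_fun_has_derivative_axis)
  then show ?thesis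
    unfolding mp_eval_def[of f] mp_deriv_def mp_eval_eq_riesz[of "sum _ _"] riesz_sum riesz_single
    by (simp only: mult_ac)
qed

lemma real_polynomial_function_imp_mpoly:
  fixes u :: "real ^ 'n::finite \<Rightarrow> real"
  assumes "real_polynomial_function u"
  obtains f :: "'n mpoly" where "u = mp_eval f"
proof -
  have "\<exists>f :: 'n mpoly. u = mp_eval f"
    using assms
  proof induction
    case (linear h)
    let ?f = "\<Sum>i\<in>UNIV. Poly_Mapping.single 0 (h (axis i 1)) * monomial (Poly_Mapping.single i 1)"
    have X: "monom_fun (Poly_Mapping.single i 1) x = x $ i" for i and x :: "real ^ 'n"
    proof -
      have "monom_fun (Poly_Mapping.single i 1) x = (\<Prod>j\<in>UNIV. if j = i then x $ i else 1)"
        unfolding monom_fun_def by (rule prod.cong) (auto simp: lookup_single when_def)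
      then show ?thesis by simp
    qed
    have "h x = mp_eval ?f x" for x
    proof -
      have "h x = h (\<Sum>i\<in>UNIV. (x $ i) *\<^sub>R axis i 1)"
        by (simp add: basis_expansion flip: scalar_mult_eq_scaleR)
      also have "\<dots> = (\<Sum>i\<in>UNIV. (x $ i) * h (axis i 1))"
        using linear by (simp add: linear_sum linear_scale bounded_linear.linear)
      finally show ?thesis using X by (simp add: mult.commute)
    qed
    then show ?case by blast
  next
    case (const c)
    show ?case by (rule exI[of _ "Poly_Mapping.single 0 c"]) (simp add: fun_eq_iff)
  next
    case (add u v)
    then obtain f h :: "'n mpoly" where "u = mp_eval f" "v = mp_eval h" by auto
    then show ?case by (intro exI[of _ "f + h"]) (simp add: fun_eq_iff)
  next
    case (mult u v)
    then obtain f h :: "'n mpoly" where "u = mp_eval f" "v = mp_eval h" by auto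
    then show ?case by (intro exI[of _ "f * h"]) (simp add: fun_eq_iff)
  qed
  then show ?thesis using that by blast
qed

lemma Stone_Weierstrass_mpoly:
  fixes u :: "real ^ 'n::finite \<Rightarrow> real"
  assumes "compact B" "continuous_on B u" "0 < e"
  obtains f :: "'n mpoly" where "\<And>x. x \<in> B \<Longrightarrow> \<bar>u x - mp_eval f x\<bar> < e"
proof -
  obtain w where "real_polynomial_function w" and w: "\<And>x. x \<in> B \<Longrightarrow> \<bar>u x - w x\<bar> < e"
    using Stone_Weierstrass_real_polynomial_function[OF assms] by blast
  then obtain f :: "'n mpoly" where "w = mp_eval f"
    using real_polynomial_function_imp_mpoly by blast
  then show ?thesis using that w by blast
qed

lemma expo_size_add: "expo_size (\<alpha> + \<beta>) = expo_size \<alpha> + expo_size \<beta>"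
  by (simp add: expo_size_def lookup_add sum.distrib)

lemma expo_size_zero [simp]: "expo_size 0 = 0"
  by (simp add: expo_size_def)

lemma expos_mono: "d \<le> d' \<Longrightarrow> expos d \<subseteq> expos d'"
  by (auto simp: expos_def)

lemma finite_expos: "finite (expos d :: 'n::finite expo set)"
proof -
  have "Poly_Mapping.lookup ` (expos d :: 'n expo set) \<subseteq> PiE UNIV (\<lambda>_. {..d})"
  proof (clarsimp simp: PiE_def Pi_def)
    fix \<gamma> :: "'n expo" and i
    assume "\<gamma> \<in> expos d"
    then have "(\<Sum>i\<in>UNIV. Poly_Mapping.lookup \<gamma> i) \<le> d" by (simp add: expos_def expo_size_def)
    moreover have "Poly_Mapping.lookup \<gamma> i \<le> (\<Sum>i\<in>UNIV. Poly_Mapping.lookup \<gamma> i)"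
      by (rule member_le_sum) auto
    ultimately show "Poly_Mapping.lookup \<gamma> i \<le> d" by simp
  qed
  then have "finite (Poly_Mapping.lookup ` (expos d :: 'n expo set))"
    by (rule finite_subset) (auto intro!: finite_PiE)
  then show ?thesis
    by (rule finite_imageD) (simp add: lookup_inject inj_on_def)
qed

lemma countable_expo: "countable (UNIV :: 'n::finite expo set)"
proof -
  have "(UNIV :: 'n expo set) = (\<Union>d. expos d)" by (auto simp: expos_def)
  then show ?thesis
    using countable_UN[of UNIV "expos :: nat \<Rightarrow> 'n expo set"] by (simp add: countable_finite finite_expos)
qed

lemma keys_subset_expos_degree: "Poly_Mapping.keys f \<subseteq> expos (mp_degree f)"
  by (auto simp: mp_degree_def expos_def intro!: Max_ge)

lemma keys_mult_subset_expos:
  assumes "Poly_Mapping.keys f \<subseteq> expos a" "Poly_Mapping.keys h \<subseteq> expos b"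
  shows "Poly_Mapping.keys (f * h) \<subseteq> expos (a + b)"
proof
  fix \<gamma> assume "\<gamma> \<in> Poly_Mapping.keys (f * h)"
  then obtain \<alpha> \<beta> where "\<gamma> = \<alpha> + \<beta>" "\<alpha> \<in> Poly_Mapping.keys f" "\<beta> \<in> Poly_Mapping.keys h"
    using keys_mult[of f h] by auto
  then show "\<gamma> \<in> expos (a + b)"
    using assms by (fastforce simp: expos_def expo_size_add)
qed

text \<open>
  Monomials of degree at most \<open>2 * d\<close> are products of two monomials of degree at most \<open>d\<close>; this
  is how the diagonal of a moment matrix controls all of its entries.
\<close>

lemma expo_split:
  fixes \<gamma> :: "'n::finite expo"
  assumes "a \<le> expo_size \<gamma>"
  shows "\<exists>\<alpha> \<beta>. \<gamma> = \<alpha> + \<beta> \<and> expo_size \<alpha> = a"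
  using assms
proof (induction a)
  case 0
  show ?case by (intro exI[of _ 0] exI[of _ \<gamma>]) simp
next
  case (Suc a)
  then obtain \<alpha> \<beta> where ab: "\<gamma> = \<alpha> + \<beta>" "expo_size \<alpha> = a" by auto
  with Suc.prems have "expo_size \<beta> \<noteq> 0" by (simp add: expo_size_add)
  then obtain i where i: "Poly_Mapping.lookup \<beta> i \<noteq> 0" by (auto simp: expo_size_def)
  let ?u = "Poly_Mapping.single i 1 :: 'n expo"
  have "\<beta> = ?u + (\<beta> - ?u)"
    by (rule poly_mapping_eqI) (use i in \<open>auto simp: lookup_add lookup_minus lookup_single when_def\<close>)
  then have "\<gamma> = (\<alpha> + ?u) + (\<beta> - ?u)" using ab by (metis add.assoc)
  moreover have "expo_size ?u = 1"
    by (simp add: expo_size_def lookup_single when_def)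
  ultimately show ?case
    using ab by (intro exI[of _ "\<alpha> + ?u"] exI[of _ "\<beta> - ?u"]) (simp add: expo_size_add)
qed

section \<open>Stokes' theorem for functions vanishing on the boundary\<close>

text \<open>
  Infinitely many translates of \<open>S\<close> by short multiples of \<open>e\<close> are disjoint, have equal measure,
  and stay in one bounded region.
\<close>

lemma null_set_if_disjoint_translates:
  fixes S :: "'a::euclidean_space set"
  assumes S: "S \<in> sets borel" "bounded S" and "0 < \<delta>"
    and disj: "\<And>x t. x \<in> S \<Longrightarrow> 0 < t \<Longrightarrow> t < \<delta> \<Longrightarrow> x + t *\<^sub>R e \<notin> S"
  shows "S \<in> null_sets lborel"
proof -
  define s where "s n = \<delta> / (real n + 2)" for n :: nat
  define T where "T n = (+) (s n *\<^sub>R e) ` S" for n :: nat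
  have s: "0 < s n" "s n < \<delta>" for n
    using \<open>0 < \<delta>\<close> by (auto simp: s_def field_simps add_pos_nonneg)
  have s_less: "s n < s m" if "m < n" for m n
    using that \<open>0 < \<delta>\<close> by (auto simp: s_def field_simps)
  have lm: "S \<in> lmeasurable"
    by (rule bounded_set_imp_lmeasurable) (use S in auto)
  have T_lm: "T n \<in> lmeasurable" for n
    unfolding T_def by (rule measurable_translation[OF lm])
  have "False" if "m < n" "x \<in> T m" "x \<in> T n" for m n x
  proof -
    from that obtain u v where "u \<in> S" "v \<in> S" and uv: "x = s m *\<^sub>R e + u" "x = s n *\<^sub>R e + v"
      by (auto simp: T_def)
    have "v = u + (s m - s n) *\<^sub>R e"
      using uv by (metis add_diff_cancel_left' add.commute diff_add_eq scaleR_left_diff_distrib)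
    moreover have "0 < s m - s n" "s m - s n < \<delta>"
      using s_less[OF \<open>m < n\<close>] s(1)[of n] s(2)[of m] by auto
    ultimately show False using disj \<open>u \<in> S\<close> \<open>v \<in> S\<close> by blast
  qed
  then have df: "disjoint_family T"
    unfolding disjoint_family_on_def by (metis disjoint_iff linorder_neqE_nat)
  obtain R where R: "\<And>x. x \<in> S \<Longrightarrow> norm x \<le> R"
    using S(2) bounded_iff by blast
  have "(\<Union>n. T n) \<subseteq> cball 0 (\<delta> * norm e + R)"
  proof (clarsimp simp: T_def)
    fix n x assume "x \<in> S"
    have "norm (s n *\<^sub>R e + x) \<le> s n * norm e + norm x"
      using norm_triangle_ineq[of "s n *\<^sub>R e" x] s(1)[of n] by simp
    also have "\<dots> \<le> \<delta> * norm e + R"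
      using R[OF \<open>x \<in> S\<close>] s(2)[of n] by (intro add_mono mult_right_mono) auto
    finally show "norm (s n *\<^sub>R e + x) \<le> \<delta> * norm e + R" .
  qed
  then have "emeasure lebesgue (\<Union>n. T n) \<le> emeasure lebesgue (cball 0 (\<delta> * norm e + R) :: 'a set)"
    by (rule emeasure_mono) auto
  then have "emeasure lebesgue (\<Union>n. T n) \<noteq> \<infinity>"
    using lmeasurable_cball[of "0::'a" "\<delta> * norm e + R"]
    by (metis emeasure_eq_measure2 ennreal_neq_top infinity_ennreal_def neq_top_trans)
  then have "(\<lambda>n. measure lebesgue (T n)) sums measure lebesgue (\<Union>n. T n)"
    using T_lm by (intro measure_UNION df) auto
  moreover have "measure lebesgue (T n) = measure lebesgue S" for n
    unfolding T_def by (rule measure_translation)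
  ultimately have "summable (\<lambda>n::nat. measure lebesgue S)"
    by (simp add: sums_iff)
  then have "measure lebesgue S = 0"
    by (simp only: summable_const_iff)
  then have "S \<in> null_sets lebesgue"
    using lm by (simp add: negligible_iff_measure flip: negligible_iff_null_sets)
  then show ?thesis
    using S(1) by (simp add: null_sets_completion_iff)
qed

locale directional_derivative =
  fixes F F' :: "'a::euclidean_space \<Rightarrow> real" and e :: 'a
  assumes deriv0: "((\<lambda>t. F (x + t *\<^sub>R e)) has_real_derivative F' x) (at 0)"
    and cont_F: "continuous_on UNIV F"
    and cont_F': "continuous_on UNIV F'"
begin

lemma deriv: "((\<lambda>t. F (x + t *\<^sub>R e)) has_real_derivative F' (x + s *\<^sub>R e)) (at s)"
proof -
  have "((\<lambda>t. F (x + (t + s) *\<^sub>R e)) has_real_derivative F' (x + s *\<^sub>R e)) (at 0)"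
    using deriv0[of "x + s *\<^sub>R e"] by (simp add: algebra_simps)
  then show ?thesis
    using DERIV_shift[of "\<lambda>t. F (x + t *\<^sub>R e)" "F' (x + s *\<^sub>R e)" 0 s] by simp
qed

text \<open>
  Where \<open>F'\<close> does not vanish, the zeros of \<open>F\<close> on a line in direction \<open>e\<close> are isolated, and
  uniformly so on bounded pieces where \<open>F'\<close> is bounded away from 0; hence short translates of such
  a piece along \<open>e\<close> are disjoint from it.
\<close>

lemma null_set_simple_zeros: "{x. F x = 0 \<and> F' x \<noteq> 0} \<in> null_sets lborel"
proof -
  define Z where "Z m = {x \<in> cball 0 (real m). F x = 0 \<and> 1 / (real m + 1) \<le> \<bar>F' x\<bar>}" for m :: nat
  have [measurable]: "F \<in> borel_measurable borel" "F' \<in> borel_measurable borel"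
    by (auto intro!: borel_measurable_continuous_onI cont_F cont_F')
  have "Z m \<in> null_sets lborel" for m
  proof -
    define K where "K = cball (0::'a) (real m + norm e)"
    have "uniformly_continuous_on K F'"
      by (intro compact_uniformly_continuous continuous_on_subset[OF cont_F']) (auto simp: K_def)
    then obtain \<delta> where "0 < \<delta>"
      and \<delta>: "\<And>x y. x \<in> K \<Longrightarrow> y \<in> K \<Longrightarrow> dist y x < \<delta> \<Longrightarrow> dist (F' y) (F' x) < 1 / (real m + 1)"
      unfolding uniformly_continuous_on_def
      by (metis add_nonneg_pos divide_pos_pos of_nat_0_le_iff zero_less_one)
    define \<eta> where "\<eta> = min 1 (\<delta> / (norm e + 1))"
    have pos: "0 < norm e + 1" by (simp add: add_nonneg_pos)
    show ?thesis
    proof (rule null_set_if_disjoint_translates[of _ \<eta> e])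
      show "Z m \<in> sets borel" unfolding Z_def by measurable
      show "bounded (Z m)" by (rule bounded_subset[of "cball 0 (real m)"]) (auto simp: Z_def)
      show "0 < \<eta>" using \<open>0 < \<delta>\<close> pos by (simp add: \<eta>_def)
      fix x t assume x: "x \<in> Z m" and t: "0 < t" "t < \<eta>"
      show "x + t *\<^sub>R e \<notin> Z m"
      proof
        assume "x + t *\<^sub>R e \<in> Z m"
        then have "F (x + t *\<^sub>R e) = 0" "F (x + 0 *\<^sub>R e) = 0"
          using x by (auto simp: Z_def)
        moreover obtain s where s: "0 < s" "s < t"
          "F (x + t *\<^sub>R e) - F (x + 0 *\<^sub>R e) = (t - 0) * F' (x + s *\<^sub>R e)"
          using MVT2[OF t(1), of "\<lambda>t. F (x + t *\<^sub>R e)" "\<lambda>s. F' (x + s *\<^sub>R e)"] deriv by blast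
        ultimately have "F' (x + s *\<^sub>R e) = 0" using t by simp
        moreover have "dist (F' (x + s *\<^sub>R e)) (F' x) < 1 / (real m + 1)"
        proof (rule \<delta>)
          have "s \<le> 1" and "s < \<delta> / (norm e + 1)" using s t by (auto simp: \<eta>_def)
          then have "s * (norm e + 1) < \<delta>" using pos by (simp add: field_simps)
          moreover have "s * norm e \<le> s * (norm e + 1)" using s by (intro mult_left_mono) auto
          ultimately have "s * norm e < \<delta>" by linarith
          then show "dist (x + s *\<^sub>R e) x < \<delta>" using s by (simp add: dist_norm)
          have "s * norm e \<le> norm e" using \<open>s \<le> 1\<close> s by (simp add: mult_left_le_one_le)
          then show "x + s *\<^sub>R e \<in> K"
            using x s norm_triangle_ineq[of x "s *\<^sub>R e"] by (auto simp: K_def Z_def)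
          show "x \<in> K" using x by (auto simp: K_def Z_def intro: order_trans[of _ "real m"])
        qed
        ultimately show False using x by (simp add: Z_def dist_real_def)
      qed
    qed
  qed
  then have "(\<Union>m. Z m) \<in> null_sets lborel" by (rule null_sets_UN)
  moreover have "{x. F x = 0 \<and> F' x \<noteq> 0} \<subseteq> (\<Union>m. Z m)"
  proof clarify
    fix x assume x: "F x = 0" "F' x \<noteq> 0"
    obtain k :: nat where k: "norm x + 1 / \<bar>F' x\<bar> \<le> real k" using real_arch_simple by blast
    have "0 \<le> 1 / \<bar>F' x\<bar>" by simp
    then have "norm x \<le> real k" "1 / \<bar>F' x\<bar> \<le> real k + 1" using k norm_ge_zero[of x] by linarith+
    then have "x \<in> Z k" using x by (simp add: Z_def field_simps)
    then show "x \<in> (\<Union>m. Z m)" by blast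
  qed
  moreover have "{x. F x = 0 \<and> F' x \<noteq> 0} \<in> sets lborel" by measurable
  ultimately show ?thesis
    using null_sets_subset by blast
qed

text \<open>
  The function equal to \<open>F\<close> on \<open>A\<close> and to 0 elsewhere is Lipschitz along \<open>e\<close>, because a segment
  that leaves \<open>A\<close> meets the boundary, where \<open>F\<close> vanishes.  Its difference quotients integrate to 0 by
  translation invariance.  They converge to \<open>F'\<close> on \<open>A\<close> and to 0 elsewhere, except on the null set of
  boundary points where \<open>F'\<close> does not vanish.
\<close>

theorem integral_deriv_eq_0_if_zero_on_frontier:
  assumes A: "A \<in> sets borel" "bounded A" and front: "\<And>x. x \<in> frontier A \<Longrightarrow> F x = 0"
  shows "(LINT x|lborel. indicator A x * F' x) = 0"
proof -
  have [measurable]: "F \<in> borel_measurable borel" "F' \<in> borel_measurable borel" "A \<in> sets borel"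
    by (auto intro!: borel_measurable_continuous_onI cont_F cont_F' A)
  obtain R where R: "\<And>x. x \<in> A \<Longrightarrow> norm x \<le> R"
    using A(2) bounded_iff by blast
  define K where "K = cball (0::'a) (\<bar>R\<bar> + norm e)"
  have "compact K" "convex K" by (auto simp: K_def)
  obtain M where M: "0 \<le> M" "\<And>x. x \<in> K \<Longrightarrow> \<bar>F' x\<bar> \<le> M"
  proof -
    have "bounded (F' ` K)"
      by (intro compact_imp_bounded compact_continuous_image continuous_on_subset[OF cont_F'] \<open>compact K\<close>) auto
    then obtain b where b: "\<And>x. x \<in> K \<Longrightarrow> \<bar>F' x\<bar> \<le> b" by (auto simp: bounded_iff)
    show ?thesis by (rule that[of "\<bar>b\<bar>"]) (use b in force)+
  qed
  define G where "G x = indicator A x * F x" for x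
  define h where "h n = 1 / real (Suc n)" for n
  define q where "q n x = (G (x + h n *\<^sub>R e) - G x) / h n" for n x
  have h: "0 < h n" "h n \<le> 1" for n by (auto simp: h_def)
  have [measurable]: "G \<in> borel_measurable borel" unfolding G_def by measurable
  have "integrable lborel G"
  proof -
    have "bounded (F ` K)"
      by (intro compact_imp_bounded compact_continuous_image continuous_on_subset[OF cont_F] \<open>compact K\<close>) auto
    then obtain b where b: "\<And>x. x \<in> K \<Longrightarrow> \<bar>F x\<bar> \<le> b" by (auto simp: bounded_iff)
    have "A \<subseteq> K" proof
      fix x assume "x \<in> A"
      then show "x \<in> K" using R[of x] norm_ge_zero[of e] abs_ge_self[of R] unfolding K_def mem_cball_0 by linarith
    qed
    have "integrable lborel (\<lambda>x. indicator K x * b)"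
      using \<open>compact K\<close> by (intro integrable_mult_left integrable_real_indicator emeasure_compact_finite)
        (auto simp: borel_compact)
    then show ?thesis
    proof (rule Bochner_Integration.integrable_bound)
      show "AE x in lborel. norm (G x) \<le> norm (indicator K x * b)"
        using b by (intro AE_I2) (use \<open>A \<subseteq> K\<close> in \<open>force simp: G_def indicator_def\<close>)
    qed measurable
  qed
  have int0: "integral\<^sup>L lborel (q n) = 0" for n
  proof -
    have shift: "integral\<^sup>L lborel (\<lambda>x. G (x + c)) = integral\<^sup>L lborel G"
      and shift': "integrable lborel (\<lambda>x. G (x + c))" for c
    proof -
      have "integral\<^sup>L (distr lborel borel ((+) c)) G = integral\<^sup>L lborel (\<lambda>x. G (c + x))"
        by (rule integral_distr) auto
      then show "integral\<^sup>L lborel (\<lambda>x. G (x + c)) = integral\<^sup>L lborel G"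
        by (simp add: lborel_distr_plus add.commute)
      have "integrable (distr lborel borel ((+) c)) G"
        by (simp add: lborel_distr_plus \<open>integrable lborel G\<close>)
      then show "integrable lborel (\<lambda>x. G (x + c))"
        by (subst (asm) integrable_distr_eq) (auto simp: add.commute)
    qed
    show ?thesis
      unfolding q_def by (simp add: Bochner_Integration.integral_diff shift shift' \<open>integrable lborel G\<close>)
  qed
  have "(\<lambda>n. integral\<^sup>L lborel (q n)) \<longlonglongrightarrow> (LINT x|lborel. indicator A x * F' x)"
  proof (rule integral_dominated_convergence)
    show "integrable lborel (\<lambda>x. indicator K x * M)"
      using \<open>compact K\<close> by (intro integrable_mult_left integrable_real_indicator emeasure_compact_finite)
        (auto simp: borel_compact)
    show "AE x in lborel. norm (q n x) \<le> indicator K x * M" for n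
    proof (rule AE_I2)
      fix x :: 'a
      let ?b = "x + h n *\<^sub>R e"
      consider "x \<notin> A" "?b \<notin> A" | "x \<in> A \<or> ?b \<in> A" by blast
      then show "norm (q n x) \<le> indicator K x * M"
      proof cases
        case 1
        then show ?thesis using M by (simp add: q_def G_def)
      next
        case 2
        have he: "norm (h n *\<^sub>R e) \<le> norm e"
          using h[of n] by (simp add: mult_left_le_one_le)
        have K: "x \<in> K" "?b \<in> K"
          using 2 he norm_triangle_ineq[of x "h n *\<^sub>R e"] norm_triangle_ineq4[of ?b "h n *\<^sub>R e"]
          by (auto simp: K_def dest!: R)
        have seg: "x + s *\<^sub>R e \<in> K" if "s \<in> {0..h n}" for s
        proof -
          have "(1 - s / h n) *\<^sub>R x + (s / h n) *\<^sub>R ?b \<in> K"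
            using that h[of n] by (intro convexD_alt[OF \<open>convex K\<close> K]) auto
          moreover have "(1 - s / h n) *\<^sub>R x + (s / h n) *\<^sub>R ?b = x + s *\<^sub>R e"
            using h(1)[of n] by (simp add: algebra_simps)
          ultimately show ?thesis by simp
        qed
        have Lip: "\<bar>F (x + s *\<^sub>R e) - F (x + t *\<^sub>R e)\<bar> \<le> M * h n"
          if "s \<in> {0..h n}" "t \<in> {0..h n}" for s t
        proof -
          have "norm (F (x + s *\<^sub>R e) - F (x + t *\<^sub>R e)) \<le> M * norm (s - t)"
          proof (rule field_differentiable_bound[of "{0..h n}" "\<lambda>t. F (x + t *\<^sub>R e)" "\<lambda>s. F' (x + s *\<^sub>R e)"])
            fix z assume "z \<in> {0..h n}"
            then show "norm (F' (x + z *\<^sub>R e)) \<le> M" using M seg by simp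
          qed (use that deriv in \<open>auto intro: has_field_derivative_at_within\<close>)
          also have "\<dots> \<le> M * h n" using that M by (intro mult_left_mono) auto
          finally show ?thesis by simp
        qed
        have "\<bar>G ?b - G x\<bar> \<le> M * h n"
        proof (cases "x \<in> A \<and> ?b \<in> A")
          case True
          then show ?thesis using Lip[of "h n" 0] h[of n] by (simp add: G_def)
        next
          case False
          have "closed_segment x ?b \<inter> frontier A \<noteq> {}"
            by (rule connected_Int_frontier) (use 2 False in auto)
          then obtain u where u: "0 \<le> u" "u \<le> 1" "(1 - u) *\<^sub>R x + u *\<^sub>R ?b \<in> frontier A"
            by (auto simp: closed_segment_def)
          moreover have "(1 - u) *\<^sub>R x + u *\<^sub>R ?b = x + (u * h n) *\<^sub>R e" by (simp add: algebra_simps)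
          ultimately have "F (x + (u * h n) *\<^sub>R e) = 0" using front by metis
          moreover have "u * h n \<in> {0..h n}"
            using u h[of n] by (auto simp: mult_left_le_one_le)
          ultimately have "\<bar>F ?b\<bar> \<le> M * h n" "\<bar>F x\<bar> \<le> M * h n"
            using Lip[of "h n" "u * h n"] Lip[of 0 "u * h n"] h[of n] by auto
          moreover have "0 \<le> M * h n" using M h[of n] by simp
          ultimately show ?thesis using False by (auto simp: G_def indicator_def)
        qed
        then show ?thesis using h[of n] K by (simp add: q_def field_simps)
      qed
    qed
    have "AE x in lborel. x \<notin> {x. F x = 0 \<and> F' x \<noteq> 0}"
      by (rule AE_not_in[OF null_set_simple_zeros])
    then show "AE x in lborel. (\<lambda>n. q n x) \<longlonglongrightarrow> indicator A x * F' x"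
    proof eventually_elim
      case (elim x)
      have h0: "h \<longlonglongrightarrow> 0"
        unfolding h_def using LIMSEQ_inverse_real_of_nat by (simp add: inverse_eq_divide)
      have "filterlim h (at 0) sequentially"
        using h0 h(1) by (auto simp: filterlim_at less_imp_neq[symmetric])
      then have dq: "(\<lambda>n. (F (x + h n *\<^sub>R e) - F x) / h n) \<longlonglongrightarrow> F' x"
        using deriv0[of x] filterlim_compose[of "\<lambda>h. (F (x + h *\<^sub>R e) - F x) / h" "nhds (F' x)" "at 0" h sequentially]
        by (simp add: DERIV_def)
      have xh: "(\<lambda>n. x + h n *\<^sub>R e) \<longlonglongrightarrow> x"
        using tendsto_add[OF tendsto_const tendsto_scaleR[OF h0 tendsto_const], of x e] by simp
      consider "x \<in> interior A" | "x \<in> - closure A" | "x \<in> frontier A"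
        by (auto simp: frontier_def)
      then show ?case
      proof cases
        case 1
        then have "x \<in> A" using interior_subset by blast
        have "eventually (\<lambda>n. x + h n *\<^sub>R e \<in> interior A) sequentially"
          using topological_tendstoD[OF xh _ 1] by simp
        then have "eventually (\<lambda>n. (F (x + h n *\<^sub>R e) - F x) / h n = q n x) sequentially"
        proof eventually_elim
          case (elim n)
          then have "x + h n *\<^sub>R e \<in> A" using interior_subset by blast
          then show ?case using \<open>x \<in> A\<close> by (simp add: q_def G_def)
        qed
        then show ?thesis using Lim_transform_eventually[OF dq] \<open>x \<in> A\<close> by simp
      next
        case 2
        then have "x \<notin> A" using closure_subset by blast
        have "eventually (\<lambda>n. x + h n *\<^sub>R e \<in> - closure A) sequentially"
          by (intro topological_tendstoD[OF xh _ 2] open_Compl closed_closure)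
        then have "eventually (\<lambda>n. q n x = 0) sequentially"
        proof eventually_elim
          case (elim n)
          then have "x + h n *\<^sub>R e \<notin> A" using closure_subset by blast
          then show ?case using \<open>x \<notin> A\<close> by (simp add: q_def G_def)
        qed
        then show ?thesis using tendsto_eventually[of "\<lambda>n. q n x" 0] \<open>x \<notin> A\<close> by simp
      next
        case 3
        then have "F x = 0" "F' x = 0" using front elim by auto
        then have "\<bar>q n x\<bar> \<le> \<bar>(F (x + h n *\<^sub>R e) - F x) / h n\<bar>" for n
          using h[of n] by (simp add: q_def G_def indicator_def)
        moreover have "(\<lambda>n. \<bar>(F (x + h n *\<^sub>R e) - F x) / h n\<bar>) \<longlonglongrightarrow> 0"
          using tendsto_rabs[OF dq] \<open>F' x = 0\<close> by simp
        ultimately have "(\<lambda>n. q n x) \<longlonglongrightarrow> 0"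
          by (intro Lim_null_comparison[of "\<lambda>n. q n x", OF always_eventually]) (simp_all only: real_norm_def simp_thms)
        then show ?thesis using \<open>F' x = 0\<close> by simp
      qed
    qed
  qed (unfold q_def, measurable)
  then have "(\<lambda>n. 0) \<longlonglongrightarrow> (LINT x|lborel. indicator A x * F' x)" using int0 by simp
  then show ?thesis by (rule LIMSEQ_unique[OF _ tendsto_const])
qed

end

section \<open>Closedness and compactness of the feasible sets\<close>

lemma quadratic_form_localizing_matrix:
  fixes v :: "'n::finite expo \<Rightarrow> real" and I :: "'n expo set"
  defines "f \<equiv> \<Sum>\<alpha>\<in>I. Poly_Mapping.single \<alpha> (v \<alpha>)"
  shows "(\<Sum>\<alpha>\<in>I. \<Sum>\<beta>\<in>I. v \<alpha> * localizing_matrix h y \<alpha> \<beta> * v \<beta>) = riesz y (h * (f * f))"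
proof -
  have s: "Poly_Mapping.single (\<alpha> + \<beta>) (v \<alpha> * v \<beta>)
      = Poly_Mapping.single 0 (v \<alpha> * v \<beta>) * monomial (\<alpha> + \<beta>)" for \<alpha> \<beta>
    by (simp add: monomial_def mult_single)
  have "f * f = (\<Sum>\<alpha>\<in>I. \<Sum>\<beta>\<in>I. Poly_Mapping.single (\<alpha> + \<beta>) (v \<alpha> * v \<beta>))"
    by (simp add: f_def sum_product mult_single)
  then have "h * (f * f) = (\<Sum>\<alpha>\<in>I. \<Sum>\<beta>\<in>I. Poly_Mapping.single 0 (v \<alpha> * v \<beta>) * (h * monomial (\<alpha> + \<beta>)))"
    by (simp only: s sum_distrib_left mult.left_commute[of h])
  then show ?thesis
    by (simp only: riesz_sum riesz_const_mult localizing_matrix_def) (simp only: mult_ac)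
qed

text \<open>
  The quadratic form of a localizing matrix at the coefficients of \<open>f\<close> is the Riesz functional of
  \<open>h f\<^sup>2\<close>.  In this form a constraint visibly weakens as the order decreases, refers to finitely
  many entries, and can be tested with polynomials chosen by approximation.
\<close>

lemma psd_on_localizing_matrix_iff:
  "psd_on (expos d) (localizing_matrix h y) \<longleftrightarrow>
    (\<forall>f. Poly_Mapping.keys f \<subseteq> expos d \<longrightarrow> 0 \<le> riesz y (h * (f * f)))" (is "?L \<longleftrightarrow> ?R")
proof
  assume ?L
  show ?R
  proof clarify
    fix f :: "'a mpoly" assume f: "Poly_Mapping.keys f \<subseteq> expos d"
    have "f = (\<Sum>\<alpha>\<in>expos d. Poly_Mapping.single \<alpha> (Poly_Mapping.lookup f \<alpha>))"
      by (rule poly_mapping_eqI)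
         (use f in \<open>auto simp: lookup_sum lookup_single when_def sum.delta finite_expos in_keys_iff\<close>)
    then have "riesz y (h * (f * f)) = (\<Sum>\<alpha>\<in>expos d. \<Sum>\<beta>\<in>expos d.
        Poly_Mapping.lookup f \<alpha> * localizing_matrix h y \<alpha> \<beta> * Poly_Mapping.lookup f \<beta>)"
      using quadratic_form_localizing_matrix[of "Poly_Mapping.lookup f" h y "expos d"] by simp
    then show "0 \<le> riesz y (h * (f * f))"
      using \<open>?L\<close> by (simp add: psd_on_def)
  qed
next
  assume R: ?R
  show ?L
    unfolding psd_on_def
  proof (intro conjI ballI allI)
    show "localizing_matrix h y \<alpha> \<beta> = localizing_matrix h y \<beta> \<alpha>" for \<alpha> \<beta>
      by (simp add: localizing_matrix_def add.commute)
    fix v :: "'a expo \<Rightarrow> real"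
    have "Poly_Mapping.keys (\<Sum>\<alpha>\<in>expos d. Poly_Mapping.single \<alpha> (v \<alpha>)) \<subseteq> expos d"
      using keys_sum[of "\<lambda>\<alpha>. Poly_Mapping.single \<alpha> (v \<alpha>)" "expos d"] by (auto split: if_splits)
    then show "0 \<le> (\<Sum>\<alpha>\<in>expos d. \<Sum>\<beta>\<in>expos d. v \<alpha> * localizing_matrix h y \<alpha> \<beta> * v \<beta>)"
      unfolding quadratic_form_localizing_matrix using R by blast
  qed
qed

lemma moment_matrix_eq_localizing_matrix: "moment_matrix y = localizing_matrix 1 y"
  by (simp add: fun_eq_iff moment_matrix_def localizing_matrix_def)

text \<open>
  The constraints without the condition that the sequences be extensional: one tuple of sequences
  indexed by all exponents, such as the moments of measures or a limit of feasible points, can then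
  satisfy the constraints of every order.
\<close>

definition stokes_constraints ::
    "nat \<Rightarrow> (nat \<Rightarrow> nat) \<Rightarrow> (nat \<Rightarrow> nat \<Rightarrow> 'n::finite mpoly) \<Rightarrow> 'n mpoly \<Rightarrow> 'n mpoly
      \<Rightarrow> ('n expo \<Rightarrow> real) \<Rightarrow> nat \<Rightarrow> (nat \<Rightarrow> 'n expo \<Rightarrow> real) \<Rightarrow> bool"
  where "stokes_constraints p m g q r z d y \<longleftrightarrow>
      (\<forall>f. Poly_Mapping.keys f \<subseteq> expos d \<longrightarrow> 0 \<le> riesz z (f * f) - (\<Sum>i\<in>{1..p}. riesz (y i) (f * f))) \<and>
      (\<forall>i\<in>{1..p}. \<forall>f. Poly_Mapping.keys f \<subseteq> expos d \<longrightarrow> 0 \<le> riesz (y i) (f * f)) \<and>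
      (\<forall>i\<in>{1..p}. \<forall>j\<in>{1..m i}. \<forall>f. Poly_Mapping.keys f \<subseteq> expos (d - half_degree (g i j)) \<longrightarrow>
         0 \<le> riesz (y i) (g i j * (f * f))) \<and>
      (\<forall>i\<in>{1..p}. \<forall>k \<alpha>.
         expo_size \<alpha> + mp_degree (stokes_poly q r (prod_all p m g) \<alpha> k) \<le> 2 * d \<longrightarrow>
         riesz (y i) (stokes_poly q r (prod_all p m g) \<alpha> k) = 0)"

lemma stokes_feasible_iff:
  "y \<in> stokes_feasible p m g q r z d \<longleftrightarrow>
    y \<in> {1..p} \<rightarrow>\<^sub>E (expos (2 * d) \<rightarrow>\<^sub>E UNIV) \<and> stokes_constraints p m g q r z d y"
  unfolding stokes_feasible_def stokes_constraints_def mem_Collect_eq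
    moment_matrix_eq_localizing_matrix psd_on_localizing_matrix_iff
  by (simp add: riesz_minus_sum)

lemma half_degree_le_min_order:
  assumes "i \<in> {1..p}" "j \<in> {1..m i}"
  shows "half_degree (g i j) \<le> min_order p m g"
proof -
  have "{half_degree (g i j) | i j. i \<in> {1..p} \<and> j \<in> {1..m i}}
      \<subseteq> (\<lambda>(i, j). half_degree (g i j)) ` (SIGMA i:{1..p}. {1..m i})"
    by force
  then have "finite {half_degree (g i j) | i j. i \<in> {1..p} \<and> j \<in> {1..m i}}"
    by (rule finite_subset) simp
  then show ?thesis
    unfolding min_order_def by (rule Max_ge) (use assms in blast)
qed

lemma mp_degree_le_half_degree: "mp_degree f \<le> 2 * half_degree f"
  unfolding half_degree_def by linarith

lemma stokes_constraints_mono: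
  assumes "stokes_constraints p m g q r z d' y" "d \<le> d'"
  shows "stokes_constraints p m g q r z d y"
proof -
  have "expos d \<subseteq> (expos d' :: 'a expo set)"
    and "\<And>i j. expos (d - half_degree (g i j)) \<subseteq> expos (d' - half_degree (g i j))"
    using assms(2) by (auto intro!: expos_mono)
  then show ?thesis
    using assms unfolding stokes_constraints_def by (meson mult_le_mono2 order_trans)
qed

text \<open>
  Each constraint is a weak inequality or an equation between finite linear combinations of entries.
  The bound \<open>min_order p m g \<le> d\<close> keeps the indices that occur in localizing matrices within
  \<open>expos (2 * d)\<close>, because then \<open>deg g\<^sub>i\<^sub>j + 2 (d - r\<^sub>i\<^sub>j) \<le> 2 d\<close>.
\<close>

lemma stokes_constraints_limit:
  fixes Y :: "nat \<Rightarrow> nat \<Rightarrow> 'n::finite expo \<Rightarrow> real"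
  assumes d: "min_order p m g \<le> d"
    and ev: "\<forall>\<^sub>F n in sequentially. stokes_constraints p m g q r z d (Y n)"
    and lim: "\<And>i \<gamma>. i \<in> {1..p} \<Longrightarrow> \<gamma> \<in> expos (2 * d) \<Longrightarrow> (\<lambda>n. Y n i \<gamma>) \<longlonglongrightarrow> y i \<gamma>"
  shows "stokes_constraints p m g q r z d y"
proof -
  have L: "(\<lambda>n. riesz (Y n i) f) \<longlonglongrightarrow> riesz (y i) f"
    if "i \<in> {1..p}" "Poly_Mapping.keys f \<subseteq> expos (2 * d)" for i f
    using that by (intro tendsto_riesz lim) auto
  have sq: "Poly_Mapping.keys (f * f) \<subseteq> expos (2 * e)" if "Poly_Mapping.keys f \<subseteq> expos e"
    for f :: "'n mpoly" and e
    using keys_mult_subset_expos[OF that that] by (simp add: mult_2)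
  show ?thesis
    unfolding stokes_constraints_def
  proof (intro conjI allI ballI impI)
    fix f :: "'n mpoly" assume f: "Poly_Mapping.keys f \<subseteq> expos d"
    show "0 \<le> riesz z (f * f) - (\<Sum>i\<in>{1..p}. riesz (y i) (f * f))"
    proof (rule tendsto_lowerbound)
      show "(\<lambda>n. riesz z (f * f) - (\<Sum>i\<in>{1..p}. riesz (Y n i) (f * f)))
        \<longlonglongrightarrow> riesz z (f * f) - (\<Sum>i\<in>{1..p}. riesz (y i) (f * f))"
        by (intro tendsto_diff tendsto_const tendsto_sum L sq f)
      show "\<forall>\<^sub>F n in sequentially. 0 \<le> riesz z (f * f) - (\<Sum>i\<in>{1..p}. riesz (Y n i) (f * f))"
        using ev by eventually_elim (use f in \<open>auto simp: stokes_constraints_def\<close>)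
    qed simp
    fix i assume i: "i \<in> {1..p}"
    show "0 \<le> riesz (y i) (f * f)"
    proof (rule tendsto_lowerbound)
      show "(\<lambda>n. riesz (Y n i) (f * f)) \<longlonglongrightarrow> riesz (y i) (f * f)"
        by (intro L sq f i)
      show "\<forall>\<^sub>F n in sequentially. 0 \<le> riesz (Y n i) (f * f)"
        using ev by eventually_elim (use f i in \<open>auto simp: stokes_constraints_def\<close>)
    qed simp
  next
    fix i j and f :: "'n mpoly"
    assume i: "i \<in> {1..p}" and j: "j \<in> {1..m i}"
      and f: "Poly_Mapping.keys f \<subseteq> expos (d - half_degree (g i j))"
    have "mp_degree (g i j) + 2 * (d - half_degree (g i j)) \<le> 2 * d"
      using mp_degree_le_half_degree[of "g i j"] half_degree_le_min_order[of i p j m g] i j d by simp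
    then have K: "Poly_Mapping.keys (g i j * (f * f)) \<subseteq> expos (2 * d)"
      using keys_mult_subset_expos[OF keys_subset_expos_degree[of "g i j"] sq[OF f]] expos_mono
      by blast
    show "0 \<le> riesz (y i) (g i j * (f * f))"
    proof (rule tendsto_lowerbound)
      show "(\<lambda>n. riesz (Y n i) (g i j * (f * f))) \<longlonglongrightarrow> riesz (y i) (g i j * (f * f))"
        by (intro L K i)
      show "\<forall>\<^sub>F n in sequentially. 0 \<le> riesz (Y n i) (g i j * (f * f))"
        using ev by eventually_elim (use f i j in \<open>auto simp: stokes_constraints_def\<close>)
    qed simp
  next
    fix i k \<alpha>
    assume i: "i \<in> {1..p}"
      and deg: "expo_size \<alpha> + mp_degree (stokes_poly q r (prod_all p m g) \<alpha> k) \<le> 2 * d"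
    let ?P = "stokes_poly q r (prod_all p m g) \<alpha> k"
    have K: "Poly_Mapping.keys ?P \<subseteq> expos (2 * d)"
      using keys_subset_expos_degree[of ?P] expos_mono[of "mp_degree ?P" "2 * d"] deg by auto
    have "\<forall>\<^sub>F n in sequentially. riesz (Y n i) ?P = 0"
      using ev by eventually_elim (use i deg in \<open>auto simp: stokes_constraints_def\<close>)
    then have "(\<lambda>n. riesz (Y n i) ?P) \<longlonglongrightarrow> 0" by (rule tendsto_eventually)
    with L[OF i K] show "riesz (y i) ?P = 0" by (rule LIMSEQ_unique)
  qed
qed

lemma stokes_constraints_cong:
  assumes "min_order p m g \<le> d" "stokes_constraints p m g q r z d y"
    and "\<And>i \<gamma>. i \<in> {1..p} \<Longrightarrow> \<gamma> \<in> expos (2 * d) \<Longrightarrow> y i \<gamma> = y' i \<gamma>"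
  shows "stokes_constraints p m g q r z d y'"
  by (rule stokes_constraints_limit[where Y = "\<lambda>n. y"]) (use assms in auto)

definition truncate_tuple :: "nat \<Rightarrow> nat \<Rightarrow> (nat \<Rightarrow> 'n::finite expo \<Rightarrow> real) \<Rightarrow> nat \<Rightarrow> 'n expo \<Rightarrow> real"
  where "truncate_tuple p d y = (\<lambda>i\<in>{1..p}. \<lambda>\<gamma>\<in>expos (2 * d). y i \<gamma>)"

lemma truncate_tuple_feasible:
  assumes "min_order p m g \<le> d" "stokes_constraints p m g q r z d y"
  shows "truncate_tuple p d y \<in> stokes_feasible p m g q r z d"
proof -
  have "stokes_constraints p m g q r z d (truncate_tuple p d y)"
    by (rule stokes_constraints_cong[OF assms]) (simp add: truncate_tuple_def)
  then show ?thesis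
    by (auto simp: stokes_feasible_iff truncate_tuple_def PiE_def extensional_def)
qed

lemma objective_truncate_tuple [simp]: "objective p (truncate_tuple p d y) = objective p y"
  by (simp add: objective_def truncate_tuple_def expos_def)

lemma objective_le_moment_zero:
  assumes "stokes_constraints p m g q r z d y"
  shows "objective p y \<le> z 0"
proof -
  have "Poly_Mapping.keys (1 :: 'a mpoly) \<subseteq> expos d"
    by (simp add: expos_def)
  then have "0 \<le> riesz z (1 * 1) - (\<Sum>i\<in>{1..p}. riesz (y i) (1 * 1))"
    using assms unfolding stokes_constraints_def by blast
  then show ?thesis by (simp add: objective_def)
qed

text \<open>
  Nonnegativity at \<open>(x\<^sup>\<alpha> \<plusminus> x\<^sup>\<beta>)\<^sup>2\<close> bounds the entry at \<open>\<alpha> + \<beta>\<close> by the mean of those at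
  \<open>2\<alpha>\<close> and \<open>2\<beta>\<close>, which the first constraint dominates by \<open>z\<close>.  Splitting \<open>\<gamma>\<close> into halves makes
  this available for all indices up to \<open>2 * d\<close>, and the bound does not depend on \<open>d\<close>.
\<close>

lemma stokes_constraints_imp_bounded:
  fixes z :: "'n::finite expo \<Rightarrow> real"
  obtains W where "\<And>d y i \<gamma>. stokes_constraints p m g q r z d y \<Longrightarrow> i \<in> {1..p} \<Longrightarrow>
    \<gamma> \<in> expos (2 * d) \<Longrightarrow> \<bar>y i \<gamma>\<bar> \<le> W \<gamma>"
proof -
  have "\<forall>\<gamma> :: 'n expo. \<exists>\<alpha> \<beta>. \<gamma> = \<alpha> + \<beta> \<and> expo_size \<alpha> = expo_size \<gamma> div 2"
    by (intro allI expo_split) simp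
  then obtain a b where ab: "\<And>\<gamma> :: 'n expo. \<gamma> = a \<gamma> + b \<gamma>" "\<And>\<gamma>. expo_size (a \<gamma>) = expo_size \<gamma> div 2"
    by metis
  define W where "W \<gamma> = (z (a \<gamma> + a \<gamma>) + z (b \<gamma> + b \<gamma>)) / 2" for \<gamma>
  show ?thesis
  proof (rule that[of W])
    fix d i and y :: "nat \<Rightarrow> 'n expo \<Rightarrow> real" and \<gamma> :: "'n expo"
    assume C: "stokes_constraints p m g q r z d y" and i: "i \<in> {1..p}" and \<gamma>: "\<gamma> \<in> expos (2 * d)"
    have sz: "expo_size (a \<gamma>) \<le> d" "expo_size (b \<gamma>) \<le> d"
      using \<gamma> ab(2)[of \<gamma>] expo_size_add[of "a \<gamma>" "b \<gamma>"] ab(1)[of \<gamma>] by (auto simp: expos_def)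
    have mm: "monomial \<alpha> * monomial \<beta> = monomial (\<alpha> + \<beta>)" for \<alpha> \<beta> :: "'n expo"
      by (simp add: monomial_def mult_single)
    have le: "y i (\<alpha> + \<alpha>) \<le> z (\<alpha> + \<alpha>)" if "expo_size \<alpha> \<le> d" for \<alpha>
    proof -
      have K: "Poly_Mapping.keys (monomial \<alpha>) \<subseteq> expos d" using that by (simp add: monomial_def expos_def)
      then have "0 \<le> z (\<alpha> + \<alpha>) - (\<Sum>i\<in>{1..p}. y i (\<alpha> + \<alpha>))"
        and "\<And>i. i \<in> {1..p} \<Longrightarrow> 0 \<le> y i (\<alpha> + \<alpha>)"
        using C unfolding stokes_constraints_def by (metis (no_types, lifting) mm riesz_monomial sum.cong)+
      moreover from this(2) have "y i (\<alpha> + \<alpha>) \<le> (\<Sum>i\<in>{1..p}. y i (\<alpha> + \<alpha>))"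
        using i by (intro member_le_sum) auto
      ultimately show ?thesis by linarith
    qed
    have K: "Poly_Mapping.keys (monomial (a \<gamma>) + monomial (b \<gamma>)) \<subseteq> expos d"
      "Poly_Mapping.keys (monomial (a \<gamma>) - monomial (b \<gamma>)) \<subseteq> expos d"
      using sz keys_add[of "monomial (a \<gamma>)" "monomial (b \<gamma>)"] keys_diff[of "monomial (a \<gamma>)" "monomial (b \<gamma>)"]
      by (auto simp: monomial_def expos_def)
    have "0 \<le> riesz (y i) (f * f)" if "Poly_Mapping.keys f \<subseteq> expos d" for f
      using C i that by (auto simp: stokes_constraints_def)
    from this[OF K(1)] this[OF K(2)]
    have "0 \<le> y i (a \<gamma> + a \<gamma>) + y i (b \<gamma> + b \<gamma>) + 2 * y i \<gamma>"
      "0 \<le> y i (a \<gamma> + a \<gamma>) + y i (b \<gamma> + b \<gamma>) - 2 * y i \<gamma>"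
      using ab(1)[of \<gamma>] add.commute[of "b \<gamma>" "a \<gamma>"] by (simp_all add: ring_distribs mm)
    with le[OF sz(1)] le[OF sz(2)] show "\<bar>y i \<gamma>\<bar> \<le> W \<gamma>" by (simp add: W_def abs_le_iff)
  qed
qed

lemma pointwise_bounded_imp_convergent_subsequence:
  fixes X :: "nat \<Rightarrow> 'a \<Rightarrow> real"
  assumes "countable S" and W: "\<And>n x. x \<in> S \<Longrightarrow> \<bar>X n x\<bar> \<le> W x"
  obtains k l where "strict_mono (k :: nat \<Rightarrow> nat)" "\<And>x. x \<in> S \<Longrightarrow> (\<lambda>n. X (k n) x) \<longlonglongrightarrow> l x"
proof -
  define V where "V x = \<bar>W x\<bar> + 1" for x
  have V: "0 < V x" for x by (simp add: V_def add_nonneg_pos)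
  have bound: "norm (X n x / V x) \<le> 1" if "x \<in> S" for n x
    using W[OF that, of n] V[of x] by (simp add: V_def)
  obtain k where k: "strict_mono (k :: nat \<Rightarrow> nat)" "\<And>x. x \<in> S \<Longrightarrow> \<exists>l. (\<lambda>n. X (k n) x / V x) \<longlonglongrightarrow> l"
  proof (rule function_convergent_subsequence[OF assms(1)])
    show "norm (X n x / V x) \<le> 1" if "x \<in> S" for n x
      using bound[OF that] .
  qed (rule that)
  then obtain l where l: "\<And>x. x \<in> S \<Longrightarrow> (\<lambda>n. X (k n) x / V x) \<longlonglongrightarrow> l x" by metis
  have "(\<lambda>n. X (k n) x) \<longlonglongrightarrow> V x * l x" if "x \<in> S" for x
    using tendsto_mult_left[OF l[OF that], of "V x"] V[of x] by simp
  then show ?thesis by (rule that[OF k(1)])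
qed

text \<open>
  The orders \<open>D n\<close> may be constant, which gives optimal solutions of one program, or tend to
  infinity, which gives limits of solutions along the hierarchy.
\<close>

lemma stokes_constraints_convergent_subsequence:
  fixes Y :: "nat \<Rightarrow> nat \<Rightarrow> 'n::finite expo \<Rightarrow> real"
  assumes "\<And>n. stokes_constraints p m g q r z (D n) (Y n)"
  obtains k y where "strict_mono (k :: nat \<Rightarrow> nat)"
    "\<And>i \<gamma>. i \<in> {1..p} \<Longrightarrow> \<forall>\<^sub>F n in sequentially. \<gamma> \<in> expos (2 * D n) \<Longrightarrow> (\<lambda>n. Y (k n) i \<gamma>) \<longlonglongrightarrow> y i \<gamma>"
proof -
  obtain W where W: "\<And>d y i \<gamma>. stokes_constraints p m g q r z d y \<Longrightarrow> i \<in> {1..p} \<Longrightarrow>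
    \<gamma> \<in> expos (2 * d) \<Longrightarrow> \<bar>y i \<gamma>\<bar> \<le> W \<gamma>"
    using stokes_constraints_imp_bounded[where p = p and m = m and g = g and q = q and r = r and z = z]
    by blast
  \<comment> \<open>Entries beyond the order \<open>D n\<close> are unconstrained, hence possibly unbounded; they are replaced by 0.\<close>
  define X where "X n = (\<lambda>(i, \<gamma>). if \<gamma> \<in> expos (2 * D n) then Y n i \<gamma> else 0)" for n
  have "countable ({1..p} \<times> (UNIV :: 'n expo set))"
    by (intro countable_SIGMA countable_expo) auto
  moreover have "\<bar>X n x\<bar> \<le> \<bar>W (snd x)\<bar>" if "x \<in> {1..p} \<times> UNIV" for n x
    using W[OF assms[of n]] that by (force simp: X_def intro: order_trans[OF _ abs_ge_self])
  ultimately obtain k l where k: "strict_mono (k :: nat \<Rightarrow> nat)"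
    and l: "\<And>x. x \<in> {1..p} \<times> UNIV \<Longrightarrow> (\<lambda>n. X (k n) x) \<longlonglongrightarrow> l x"
    using pointwise_bounded_imp_convergent_subsequence[of "{1..p} \<times> UNIV" X "\<lambda>x. \<bar>W (snd x)\<bar>"] by metis
  show ?thesis
  proof (rule that[OF k, of "curry l"])
    fix i and \<gamma> :: "'n expo" assume i: "i \<in> {1..p}" and ev: "\<forall>\<^sub>F n in sequentially. \<gamma> \<in> expos (2 * D n)"
    have "\<forall>\<^sub>F n in sequentially. \<gamma> \<in> expos (2 * D (k n))"
      by (rule eventually_subseq[OF k ev])
    then have "\<forall>\<^sub>F n in sequentially. X (k n) (i, \<gamma>) = Y (k n) i \<gamma>"
      by eventually_elim (simp add: X_def)
    then show "(\<lambda>n. Y (k n) i \<gamma>) \<longlonglongrightarrow> curry l i \<gamma>"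
      using Lim_transform_eventually[OF l[of "(i, \<gamma>)"]] i by simp
  qed
qed

lemma stokes_optimal_exists:
  fixes y\<^sub>0 :: "nat \<Rightarrow> 'n::finite expo \<Rightarrow> real"
  assumes d: "min_order p m g \<le> d" and y0: "stokes_constraints p m g q r z d y\<^sub>0"
  shows "\<exists>y. stokes_optimal p m g q r z d y"
proof -
  let ?F = "stokes_feasible p m g q r z d"
  have ne: "objective p ` ?F \<noteq> {}"
    using truncate_tuple_feasible[OF d y0] by blast
  have bdd: "bdd_above (objective p ` ?F)"
    by (rule bdd_aboveI[of _ "z 0"]) (auto simp: stokes_feasible_iff intro: objective_le_moment_zero)
  define s where "s = Sup (objective p ` ?F)"
  have "\<exists>y\<in>?F. s - 1 / real (Suc n) < objective p y" for n
    using less_cSup_iff[OF ne bdd, of "s - 1 / real (Suc n)"] by (auto simp: s_def)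
  then obtain Y where Y: "\<And>n. Y n \<in> ?F" "\<And>n. s - 1 / real (Suc n) < objective p (Y n)"
    by metis
  have C: "stokes_constraints p m g q r z d (Y n)" for n using Y(1) by (simp add: stokes_feasible_iff)
  obtain k y where k: "strict_mono k"
    and y': "\<And>i \<gamma>. i \<in> {1..p} \<Longrightarrow> \<forall>\<^sub>F n in sequentially. \<gamma> \<in> expos (2 * d) \<Longrightarrow>
      (\<lambda>n. Y (k n) i \<gamma>) \<longlonglongrightarrow> y i \<gamma>"
    using stokes_constraints_convergent_subsequence[where D = "\<lambda>n. d" and Y = Y, OF C] by blast
  have y: "(\<lambda>n. Y (k n) i \<gamma>) \<longlonglongrightarrow> y i \<gamma>" if "i \<in> {1..p}" "\<gamma> \<in> expos (2 * d)" for i \<gamma>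
    by (rule y') (use that in auto)
  have "stokes_constraints p m g q r z d y"
    by (rule stokes_constraints_limit[where Y = "\<lambda>n. Y (k n)"]) (use d C y in auto)
  then have feas: "truncate_tuple p d y \<in> ?F" by (rule truncate_tuple_feasible[OF d])
  have "(\<lambda>n. objective p (Y (k n))) \<longlonglongrightarrow> objective p y"
    unfolding objective_def by (intro tendsto_sum y) (auto simp: expos_def)
  moreover have "(\<lambda>n. s - 1 / real (Suc (k n))) \<longlonglongrightarrow> s - 0"
    using LIMSEQ_subseq_LIMSEQ[OF LIMSEQ_inverse_real_of_nat k]
    by (intro tendsto_intros) (simp add: o_def inverse_eq_divide)
  ultimately have "s \<le> objective p y"
    using LIMSEQ_le[of "\<lambda>n. s - 1 / real (Suc (k n))" s "\<lambda>n. objective p (Y (k n))" "objective p y"]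
      less_imp_le[OF Y(2)] by auto
  moreover have "objective p y' \<le> s" if "y' \<in> ?F" for y'
    unfolding s_def by (rule cSup_upper[OF imageI[OF that] bdd])
  ultimately have "\<And>y'. y' \<in> ?F \<Longrightarrow> objective p y' \<le> objective p y" by force
  then have "stokes_value p m g q r z d = ereal (objective p (truncate_tuple p d y))"
    unfolding stokes_value_def using feas
    by (intro antisym SUP_least SUP_upper) auto
  then show ?thesis
    using feas by (auto simp: stokes_optimal_def)
qed

lemma stokes_value_antimono:
  assumes d: "min_order p m g \<le> d" and "d \<le> d'"
  shows "stokes_value p m g q r z d' \<le> stokes_value p m g q r z d"
  unfolding stokes_value_def
proof (rule SUP_mono)
  fix y assume "y \<in> stokes_feasible p m g q r z d'"
  then have "stokes_constraints p m g q r z d y"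
    using stokes_constraints_mono assms(2) by (auto simp: stokes_feasible_iff)
  then show "\<exists>y'\<in>stokes_feasible p m g q r z d. ereal (objective p y) \<le> ereal (objective p y')"
    using truncate_tuple_feasible[OF d] by (intro bexI[of _ "truncate_tuple p d y"]) auto
qed

section \<open>The restrictions of the measure as a feasible point\<close>

lemma closed_basic_set: "closed (basic_set m g i)"
proof -
  have "basic_set m g i = (\<Inter>j\<in>{1..m i}. {x. 0 \<le> mp_eval (g i j) x})"
    by (auto simp: basic_set_def)
  then show ?thesis
    by (auto intro!: closed_INT closed_Collect_le continuous_intros)
qed

lemma frontier_basic_set:
  assumes "x \<in> frontier (basic_set m g i)"
  shows "\<exists>j\<in>{1..m i}. mp_eval (g i j) x = 0"
proof (rule ccontr)
  assume "\<not> ?thesis"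
  moreover have "x \<in> basic_set m g i"
    using assms closed_basic_set frontier_subset_closed by blast
  ultimately have pos: "x \<in> (\<Inter>j\<in>{1..m i}. {x. 0 < mp_eval (g i j) x})"
    by (force simp: basic_set_def order_less_le)
  have "open (\<Inter>j\<in>{1..m i}. {x. 0 < mp_eval (g i j) x})"
    by (auto intro!: open_INT open_Collect_less continuous_intros)
  moreover have "(\<Inter>j\<in>{1..m i}. {x. 0 < mp_eval (g i j) x}) \<subseteq> basic_set m g i"
    by (force simp: basic_set_def)
  ultimately have "x \<in> interior (basic_set m g i)"
    using pos interiorI by blast
  with assms show False by (simp add: frontier_def)
qed

text \<open>
  The second factor \<open>q\<close> makes the derivative of \<open>x\<^sup>\<alpha> h q\<^sup>2 exp r\<close> a polynomial multiple of the density
  \<open>q exp r\<close>, also where \<open>q\<close> vanishes; the factor \<open>h\<close> will make it vanish on the boundary.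
\<close>

lemma directional_derivative_stokes_poly:
  fixes q r h :: "'n::finite mpoly"
  shows "directional_derivative
    (\<lambda>x. mp_eval (monomial \<alpha> * h) x * (mp_eval q x)\<^sup>2 * exp (mp_eval r x))
    (\<lambda>x. mp_eval (stokes_poly q r h \<alpha> k) x * (mp_eval q x * exp (mp_eval r x)))
    (axis k 1)"
proof
  fix x :: "real ^ 'n"
  define H where "H = monomial \<alpha> * h"
  have "stokes_poly q r h \<alpha> k = q * mp_deriv k H + 2 * (H * mp_deriv k q) + H * q * mp_deriv k r"
    by (simp add: stokes_poly_def H_def mult.assoc)
  then show "((\<lambda>t. mp_eval (monomial \<alpha> * h) (x + t *\<^sub>R axis k 1) * (mp_eval q (x + t *\<^sub>R axis k 1))\<^sup>2
      * exp (mp_eval r (x + t *\<^sub>R axis k 1))) has_real_derivative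
    mp_eval (stokes_poly q r h \<alpha> k) x * (mp_eval q x * exp (mp_eval r x))) (at 0)"
    unfolding H_def[symmetric]
    by (auto intro!: derivative_eq_intros mp_eval_has_derivative_axis
        simp: algebra_simps power2_eq_square)
qed (intro continuous_intros)+

locale stokes_setting =
  fixes B \<Omega> :: "(real ^ 'n::finite) set"
    and \<mu> :: "(real ^ 'n) measure"
    and q r :: "'n mpoly"
    and p :: nat
    and m :: "nat \<Rightarrow> nat"
    and g :: "nat \<Rightarrow> nat \<Rightarrow> 'n mpoly"
  assumes box: "is_box B"
    and sets_\<mu>: "sets \<mu> = sets borel"
    and fin_\<mu>: "finite_measure \<mu>"
    and support_\<mu>: "measure_support \<mu> = B"
    and density_\<mu>: "\<mu> = density lborel (\<lambda>x. ennreal (mp_eval q x * exp (mp_eval r x) * indicator B x))"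
    and Omega_eq: "\<Omega> = (\<Union>i\<in>{1..p}. basic_set m g i)"
    and Omega_subset: "\<Omega> \<subseteq> B"
begin

sublocale finite_measure \<mu> by (rule fin_\<mu>)

declare sets_\<mu> [measurable_cong]

lemma compact_B: "compact B"
  using box by (auto simp: is_box_def)

lemma B_borel [measurable]: "B \<in> sets borel"
  using compact_B by (simp add: borel_compact)

lemma Omega_borel [measurable]: "\<Omega> \<in> sets borel"
  unfolding Omega_eq by (intro sets.finite_UN borel_closed closed_basic_set) auto

lemma AE_in_B: "AE x in \<mu>. x \<in> B"
proof -
  have "AE x in lborel. 0 < ennreal (mp_eval q x * exp (mp_eval r x) * indicator B x) \<longrightarrow> x \<in> B"
    by (rule AE_I2) (auto simp: indicator_def split: if_splits)
  moreover have "(\<lambda>x. ennreal (mp_eval q x * exp (mp_eval r x) * indicator B x)) \<in> borel_measurable lborel"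
    by measurable
  ultimately show ?thesis
    by (subst density_\<mu>) (simp add: AE_density)
qed

text \<open>
  In the definition of \<open>\<mu>\<close> the conversion to extended nonnegative reals cuts off negative values of
  the density.  If \<open>q x < 0\<close>, a neighbourhood of \<open>x\<close> has measure 0, so \<open>x\<close> is not in the support.
\<close>

lemma q_nonneg:
  assumes "x \<in> B" shows "0 \<le> mp_eval q x"
proof (rule ccontr)
  assume "\<not> 0 \<le> mp_eval q x"
  define U where "U = {x. mp_eval q x < 0}"
  have U: "open U" "x \<in> U"
    using \<open>\<not> 0 \<le> mp_eval q x\<close> by (auto simp: U_def intro!: open_Collect_less continuous_intros)
  have [measurable]: "U \<in> sets borel" using U by simp
  have "emeasure \<mu> U = (\<integral>\<^sup>+x. ennreal (mp_eval q x * exp (mp_eval r x) * indicator B x) * indicator U x \<partial>lborel)"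
    by (subst density_\<mu>, rule emeasure_density) auto
  also have "\<dots> = (\<integral>\<^sup>+x. 0 \<partial>(lborel :: (real ^ 'n) measure))"
    by (rule nn_integral_cong)
       (auto simp: U_def indicator_def ennreal_eq_0_iff mult_nonpos_nonneg)
  finally have "emeasure \<mu> U = 0" by simp
  with U assms support_\<mu> show False by (force simp: measure_support_def)
qed

lemma integrable_bounded_on_B:
  assumes "u \<in> borel_measurable borel" "\<And>x. x \<in> B \<Longrightarrow> \<bar>u x\<bar> \<le> (c::real)"
  shows "integrable \<mu> u"
proof (rule integrable_const_bound)
  show "AE x in \<mu>. norm (u x) \<le> c"
    using AE_in_B by eventually_elim (use assms in auto)
qed (use assms in measurable)

lemma mp_eval_bounded_on_B: obtains c where "0 < c" "\<And>x. x \<in> B \<Longrightarrow> \<bar>mp_eval f x\<bar> \<le> c"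
proof -
  have "bounded (mp_eval f ` B)"
    by (intro compact_imp_bounded compact_continuous_image continuous_intros compact_B)
  then obtain c where "0 < c" "\<forall>y\<in>mp_eval f ` B. norm y \<le> c"
    unfolding bounded_pos by blast
  then show ?thesis using that by auto
qed

lemma integrable_indicator_mp_eval [simp]:
  assumes [measurable]: "A \<in> sets borel"
  shows "integrable \<mu> (\<lambda>x. indicator A x * mp_eval f x)"
proof -
  obtain c where "0 < c" "\<And>x. x \<in> B \<Longrightarrow> \<bar>mp_eval f x\<bar> \<le> c" by (rule mp_eval_bounded_on_B[of f]) blast
  then show ?thesis
    by (intro integrable_bounded_on_B[of _ c]) (auto simp: indicator_def)
qed

lemma integrable_mp_eval [simp]: "integrable \<mu> (mp_eval f)"
  using integrable_indicator_mp_eval[of UNIV f] by simp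

definition moment_on :: "(real ^ 'n) set \<Rightarrow> 'n expo \<Rightarrow> real"
  where "moment_on A \<gamma> = (LINT x|\<mu>. indicator A x * monom_fun \<gamma> x)"

lemma riesz_moment_on:
  assumes [measurable]: "A \<in> sets borel"
  shows "riesz (moment_on A) f = (LINT x|\<mu>. indicator A x * mp_eval f x)"
proof -
  have int: "integrable \<mu> (\<lambda>x. indicator A x * monom_fun \<gamma> x)" for \<gamma>
    using integrable_indicator_mp_eval[of A "monomial \<gamma>"] assms by simp
  have "(LINT x|\<mu>. indicator A x * mp_eval f x)
      = (LINT x|\<mu>. (\<Sum>\<gamma>\<in>Poly_Mapping.keys f. Poly_Mapping.lookup f \<gamma> * (indicator A x * monom_fun \<gamma> x)))"
    by (simp add: mp_eval_def sum_distrib_left mult_ac)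
  also have "\<dots> = riesz (moment_on A) f"
    by (simp add: Bochner_Integration.integral_sum int riesz_def moment_on_def)
  finally show ?thesis by simp
qed

lemma moment_eq_moment_on: "moment \<mu> = moment_on UNIV"
  by (simp add: fun_eq_iff moment_def moment_on_def)

lemma riesz_moment: "riesz (moment \<mu>) f = (LINT x|\<mu>. mp_eval f x)"
  by (simp add: moment_eq_moment_on riesz_moment_on)

text \<open>
  The pieces are disjoint with union \<open>\<Omega>\<close>, so that the restrictions of \<open>\<mu>\<close> to them add up to its
  restriction to \<open>\<Omega>\<close>.  Their boundaries lie in the union of the boundaries of the \<open>\<Omega>\<^sub>i\<close>, where the
  product of all \<open>g\<^sub>i\<^sub>j\<close> vanishes.
\<close>

definition piece :: "nat \<Rightarrow> (real ^ 'n) set"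
  where "piece i = basic_set m g i - (\<Union>j\<in>{1..<i}. basic_set m g j)"

lemma piece_borel [measurable]: "piece i \<in> sets borel"
  unfolding piece_def by (intro sets.Diff sets.finite_UN borel_closed closed_basic_set) auto

lemma disjoint_family_piece: "disjoint_family_on piece {1..p}"
proof -
  have "piece i \<inter> piece j = {}" if "i < j" "1 \<le> i" for i j
    using that by (auto simp: piece_def)
  then show ?thesis
    unfolding disjoint_family_on_def by (metis Int_commute atLeastAtMost_iff linorder_neqE_nat)
qed

lemma UN_piece: "(\<Union>i\<in>{1..p}. piece i) = \<Omega>"
proof
  show "\<Omega> \<subseteq> (\<Union>i\<in>{1..p}. piece i)"
  proof
    fix x assume "x \<in> \<Omega>"
    then have ex: "\<exists>i. i \<in> {1..p} \<and> x \<in> basic_set m g i" by (auto simp: Omega_eq)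
    define i where "i = (LEAST i. i \<in> {1..p} \<and> x \<in> basic_set m g i)"
    have i: "i \<in> {1..p}" "x \<in> basic_set m g i"
      using LeastI_ex[OF ex] unfolding i_def by blast+
    have "x \<notin> basic_set m g j" if "j \<in> {1..<i}" for j
      using not_less_Least[of j "\<lambda>i. i \<in> {1..p} \<and> x \<in> basic_set m g i"] that i(1)
      unfolding i_def by auto
    then have "x \<in> piece i" using i by (auto simp: piece_def)
    then show "x \<in> (\<Union>i\<in>{1..p}. piece i)" using i by blast
  qed
qed (auto simp: piece_def Omega_eq)

lemma sum_indicator_piece: "(\<Sum>i\<in>{1..p}. indicator (piece i) x) = (indicator \<Omega> x :: real)"
  by (rule indicator_UN_disjoint[OF _ disjoint_family_piece, unfolded UN_piece, symmetric]) simp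

lemma sum_riesz_pieces:
  "(\<Sum>i\<in>{1..p}. riesz (moment_on (piece i)) f) = (LINT x|\<mu>. indicator \<Omega> x * mp_eval f x)"
proof -
  have "(\<Sum>i\<in>{1..p}. riesz (moment_on (piece i)) f)
      = (LINT x|\<mu>. (\<Sum>i\<in>{1..p}. indicator (piece i) x * mp_eval f x))"
    by (subst Bochner_Integration.integral_sum) (simp_all only: riesz_moment_on[OF piece_borel]
      integrable_indicator_mp_eval[OF piece_borel])
  also have "\<dots> = (LINT x|\<mu>. indicator \<Omega> x * mp_eval f x)"
    by (simp only: sum_indicator_piece flip: sum_distrib_right)
  finally show ?thesis .
qed

lemma frontier_piece:
  assumes "i \<in> {1..p}" "x \<in> frontier (piece i)"
  shows "mp_eval (prod_all p m g) x = 0"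
proof -
  have "frontier (piece i) \<subseteq> frontier (basic_set m g i) \<union> frontier (\<Union>j\<in>{1..<i}. basic_set m g j)"
    unfolding piece_def Diff_eq by (metis frontier_Int_subset frontier_complement)
  moreover have "frontier (\<Union>j\<in>{1..<i}. basic_set m g j) \<subseteq> (\<Union>j\<in>{1..<i}. frontier (basic_set m g j))"
    using frontier_Union_subset[of "basic_set m g ` {1..<i}"] by simp
  ultimately obtain j where "j \<in> {1..p}" "x \<in> frontier (basic_set m g j)"
    using assms by fastforce
  then obtain l where "l \<in> {1..m j}" "mp_eval (g j l) x = 0" using frontier_basic_set by blast
  then show ?thesis using \<open>j \<in> {1..p}\<close> by (force simp: prod_all_def)
qed

lemma riesz_stokes_poly_piece:
  assumes i: "i \<in> {1..p}"
  shows "riesz (moment_on (piece i)) (stokes_poly q r (prod_all p m g) \<alpha> k) = 0"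
proof -
  let ?P = "stokes_poly q r (prod_all p m g) \<alpha> k"
  have sub: "piece i \<subseteq> B"
    using i UN_piece Omega_subset by blast
  then have "bounded (piece i)" using compact_B bounded_subset compact_imp_bounded by blast
  have "riesz (moment_on (piece i)) ?P = (LINT x|\<mu>. indicator (piece i) x * mp_eval ?P x)"
    by (simp add: riesz_moment_on)
  also have "\<dots> = (LINT x|lborel. (mp_eval q x * exp (mp_eval r x) * indicator B x) *\<^sub>R
      (indicator (piece i) x * mp_eval ?P x))"
    by (subst density_\<mu>, rule integral_density) (auto simp: indicator_def q_nonneg)
  also have "\<dots> = (LINT x|lborel. indicator (piece i) x * (mp_eval ?P x * (mp_eval q x * exp (mp_eval r x))))"
    by (rule Bochner_Integration.integral_cong) (use sub in \<open>auto simp: indicator_def\<close>)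
  also have "\<dots> = 0"
    by (rule directional_derivative.integral_deriv_eq_0_if_zero_on_frontier[OF directional_derivative_stokes_poly])
       (use \<open>bounded (piece i)\<close> frontier_piece[OF i] in auto)
  finally show ?thesis .
qed

text \<open>
  The semidefinite constraints express that integrals of nonnegative functions are nonnegative.  The
  objective at this point is \<open>measure \<mu> \<Omega>\<close>, which is therefore a lower bound for the optimal values.
\<close>

lemma stokes_constraints_pieces:
  "stokes_constraints p m g q r (moment \<mu>) d (\<lambda>i. moment_on (piece i))"
  unfolding stokes_constraints_def
proof (intro conjI allI ballI impI)
  fix f :: "'n mpoly"
  have "(LINT x|\<mu>. indicator \<Omega> x * mp_eval (f * f) x) \<le> (LINT x|\<mu>. mp_eval (f * f) x)"
  proof (rule integral_mono)
    show "indicator \<Omega> x * mp_eval (f * f) x \<le> mp_eval (f * f) x" for x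
      by (simp add: indicator_def)
  qed (rule integrable_indicator_mp_eval integrable_mp_eval Omega_borel)+
  then show "0 \<le> riesz (moment \<mu>) (f * f) - (\<Sum>i\<in>{1..p}. riesz (moment_on (piece i)) (f * f))"
    unfolding sum_riesz_pieces riesz_moment by (simp only: diff_ge_0_iff_ge)
next
  fix i and f :: "'n mpoly"
  show "0 \<le> riesz (moment_on (piece i)) (f * f)"
    unfolding riesz_moment_on[OF piece_borel] by (rule integral_nonneg_AE) (simp add: indicator_def)
next
  fix i j and f :: "'n mpoly" assume "j \<in> {1..m i}"
  then show "0 \<le> riesz (moment_on (piece i)) (g i j * (f * f))"
    unfolding riesz_moment_on[OF piece_borel]
    by (intro integral_nonneg_AE AE_I2) (auto simp: indicator_def piece_def basic_set_def)
next
  fix i k \<alpha> assume "i \<in> {1..p}"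
  then show "riesz (moment_on (piece i)) (stokes_poly q r (prod_all p m g) \<alpha> k) = 0"
    by (rule riesz_stokes_poly_piece)
qed

lemma objective_pieces: "objective p (\<lambda>i. moment_on (piece i)) = measure \<mu> \<Omega>"
proof -
  have "objective p (\<lambda>i. moment_on (piece i)) = (\<Sum>i\<in>{1..p}. riesz (moment_on (piece i)) 1)"
    by (simp add: objective_def)
  also have "\<dots> = measure \<mu> \<Omega>"
    unfolding sum_riesz_pieces using sets_eq_imp_space_eq[OF sets_\<mu>] by simp
  finally show ?thesis .
qed

end

section \<open>Tuples satisfying the constraints of every order\<close>

text \<open>
  On \<open>B\<close> a nonnegative \<open>f\<close> is uniformly close to the square of a polynomial approximating \<open>sqrt f\<close>,
  and \<open>T\<close> is continuous for uniform convergence on \<open>B\<close>.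
\<close>

lemma nonneg_if_nonneg_on_squares:
  fixes T :: "'n::finite mpoly \<Rightarrow> real"
  assumes "compact B"
    and diff: "\<And>f h. T (f - h) = T f - T h"
    and square: "\<And>f. 0 \<le> T (f * f)"
    and bound: "\<And>f c. 0 < c \<Longrightarrow> (\<And>x. x \<in> B \<Longrightarrow> \<bar>mp_eval f x\<bar> \<le> c) \<Longrightarrow> \<bar>T f\<bar> \<le> c * K"
    and f: "\<And>x. x \<in> B \<Longrightarrow> 0 \<le> mp_eval f x"
  shows "0 \<le> T f"
proof -
  let ?s = "\<lambda>x. sqrt (mp_eval f x)"
  have cont: "continuous_on B ?s" by (intro continuous_intros)
  then have "bounded (?s ` B)"
    by (intro compact_imp_bounded compact_continuous_image \<open>compact B\<close>)
  then obtain S where S: "0 < S" "\<And>x. x \<in> B \<Longrightarrow> \<bar>?s x\<bar> \<le> S"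
    unfolding bounded_pos by auto
  have "0 \<le> T f + e" if "0 < e" for e
  proof -
    define \<eta> where "\<eta> = e / (\<bar>K\<bar> + 1)"
    define \<delta> where "\<delta> = min 1 (\<eta> / (2 * S + 1))"
    have pos: "0 < \<bar>K\<bar> + 1" by (simp add: add_nonneg_pos)
    then have "0 < \<eta>" using that by (simp add: \<eta>_def)
    then have \<delta>: "0 < \<delta>" "\<delta> \<le> 1" "\<delta> \<le> \<eta> / (2 * S + 1)"
      using S(1) by (auto simp: \<delta>_def)
    then have \<delta>_mult: "\<delta> * (2 * S + 1) \<le> \<eta>"
      using S(1) by (simp add: pos_le_divide_eq)
    obtain w :: "'n mpoly" where w: "\<And>x. x \<in> B \<Longrightarrow> \<bar>?s x - mp_eval w x\<bar> < \<delta>"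
      using Stone_Weierstrass_mpoly[OF \<open>compact B\<close> cont \<delta>(1)] by blast
    have "\<bar>mp_eval (f - w * w) x\<bar> \<le> \<eta>" if "x \<in> B" for x
    proof -
      have "mp_eval (f - w * w) x = (?s x - mp_eval w x) * (?s x + mp_eval w x)"
        using f[OF that] by (simp add: algebra_simps)
      moreover have "\<bar>?s x + mp_eval w x\<bar> \<le> 2 * S + 1"
        using w[OF that] S(2)[OF that] \<delta>(2) by linarith
      ultimately have "\<bar>mp_eval (f - w * w) x\<bar> \<le> \<delta> * (2 * S + 1)"
        unfolding abs_mult using w[OF that] \<delta>(1) by (simp only: abs_mult) (intro mult_mono, auto)
      then show ?thesis using \<delta>_mult by linarith
    qed
    then have "\<bar>T (f - w * w)\<bar> \<le> \<eta> * K" by (rule bound[OF \<open>0 < \<eta>\<close>])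
    also have "\<dots> \<le> \<eta> * (\<bar>K\<bar> + 1)" using \<open>0 < \<eta>\<close> by (intro mult_left_mono) auto
    also have "\<dots> = e" using pos by (simp add: \<eta>_def)
    finally show ?thesis using square[of w] diff[of f "w * w"] by linarith
  qed
  then show ?thesis by (rule field_le_epsilon)
qed

text \<open>
  The functionals \<open>riesz (y i)\<close> behave like integrals with respect to measures on \<open>\<Omega>\<^sub>i\<close> whose sum is
  dominated by \<open>\<mu>\<close>.  The inequalities for nonnegative polynomials that express this are derived from
  those for squares.
\<close>

locale limit_tuple = stokes_setting +
  fixes y :: "nat \<Rightarrow> 'a expo \<Rightarrow> real"
  assumes constraints: "\<And>d. min_order p m g \<le> d \<Longrightarrow> stokes_constraints p m g q r (moment \<mu>) d y"
begin

lemma riesz_square: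
  shows "(\<Sum>i\<in>{1..p}. riesz (y i) (f * f)) \<le> (LINT x|\<mu>. mp_eval (f * f) x)"
    and "i \<in> {1..p} \<Longrightarrow> 0 \<le> riesz (y i) (f * f)"
    and "i \<in> {1..p} \<Longrightarrow> j \<in> {1..m i} \<Longrightarrow> 0 \<le> riesz (y i) (g i j * (f * f))"
proof -
  have C: "stokes_constraints p m g q r (moment \<mu>) (min_order p m g + mp_degree f) y"
    by (rule constraints) simp
  have K: "Poly_Mapping.keys f \<subseteq> expos (mp_degree f + e)" for e
    using keys_subset_expos_degree expos_mono[of "mp_degree f" "mp_degree f + e"] by fastforce
  show "(\<Sum>i\<in>{1..p}. riesz (y i) (f * f)) \<le> (LINT x|\<mu>. mp_eval (f * f) x)"
    and "i \<in> {1..p} \<Longrightarrow> 0 \<le> riesz (y i) (f * f)"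
    using C K[of "min_order p m g"] unfolding stokes_constraints_def riesz_moment
    by (simp_all add: add.commute del: mp_eval_mult)
  assume i: "i \<in> {1..p}" and j: "j \<in> {1..m i}"
  then have "min_order p m g + mp_degree f - half_degree (g i j)
      = mp_degree f + (min_order p m g - half_degree (g i j))"
    using half_degree_le_min_order[of i p j m g] by simp
  then show "0 \<le> riesz (y i) (g i j * (f * f))"
    using C K i j unfolding stokes_constraints_def by simp
qed

abbreviation "mass \<equiv> measure \<mu> UNIV"

lemma space_\<mu> [simp]: "space \<mu> = UNIV"
  using sets_eq_imp_space_eq[OF sets_\<mu>] by simp

lemma integral_mono_on_B:
  assumes "integrable \<mu> u" "integrable \<mu> v" "\<And>x. x \<in> B \<Longrightarrow> u x \<le> (v x :: real)"
  shows "integral\<^sup>L \<mu> u \<le> integral\<^sup>L \<mu> v"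
proof (rule integral_mono_AE[OF assms(1,2)])
  show "AE x in \<mu>. u x \<le> v x"
    using AE_in_B by eventually_elim (rule assms(3))
qed

text \<open>
  Apply \<open>riesz (y i)\<close> to \<open>(f \<plusminus> c)\<^sup>2\<close> and dominate the squares by their integrals.
\<close>

lemma riesz_bound:
  assumes i: "i \<in> {1..p}" and c: "0 < c" "\<And>x. x \<in> B \<Longrightarrow> \<bar>mp_eval f x\<bar> \<le> c"
  shows "\<bar>riesz (y i) f\<bar> \<le> c * mass"
proof -
  let ?L = "riesz (y i)" and ?c = "Poly_Mapping.single 0 c :: 'a mpoly"
  have le: "?L (h * h) \<le> e\<^sup>2 * mass" if h: "\<And>x. x \<in> B \<Longrightarrow> \<bar>mp_eval h x\<bar> \<le> e" for h e
  proof -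
    have "?L (h * h) \<le> (\<Sum>i\<in>{1..p}. riesz (y i) (h * h))"
      using i riesz_square(2)[of _ h] by (intro member_le_sum) auto
    also have "\<dots> \<le> (LINT x|\<mu>. mp_eval (h * h) x)" by (rule riesz_square(1))
    also have "\<dots> \<le> (LINT x|\<mu>. e\<^sup>2)"
    proof (rule integral_mono_on_B)
      fix x assume "x \<in> B"
      then have "(mp_eval h x)\<^sup>2 \<le> e\<^sup>2" using h[of x] by (simp add: abs_le_square_iff[symmetric])
      then show "mp_eval (h * h) x \<le> e\<^sup>2" by (simp add: power2_eq_square)
    qed (simp_all only: integrable_mp_eval integrable_const)
    finally show ?thesis by (simp add: mult.commute)
  qed
  have "?L 1 \<le> mass" using le[of 1 1] by simp
  have "0 \<le> ?L ((f + ?c) * (f + ?c))" "0 \<le> ?L ((f - ?c) * (f - ?c))"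
    using riesz_square(2)[OF i] by blast+
  moreover have "?L (?c * ?c) = c\<^sup>2 * ?L 1"
    by (simp add: power2_eq_square mult_single)
  moreover have "?L (f * f) \<le> c\<^sup>2 * mass" using le c(2) by blast
  moreover have "c\<^sup>2 * ?L 1 \<le> c\<^sup>2 * mass" using \<open>?L 1 \<le> mass\<close> by (intro mult_left_mono) auto
  ultimately have "2 * (c * ?L f) \<le> 2 * (c * (c * mass))" "- (2 * (c * ?L f)) \<le> 2 * (c * (c * mass))"
    by (simp_all add: ring_distribs power2_eq_square)
  then have "c * ?L f \<le> c * (c * mass)" "c * (- ?L f) \<le> c * (c * mass)" by simp_all
  then show ?thesis using c(1) by (simp only: mult_le_cancel_left_pos)
qed

lemma riesz_nonneg:
  assumes "i \<in> {1..p}" "\<And>x. x \<in> B \<Longrightarrow> 0 \<le> mp_eval f x"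
  shows "0 \<le> riesz (y i) f"
  by (rule nonneg_if_nonneg_on_squares[OF compact_B, where K = mass])
     (use assms riesz_bound riesz_square in auto)

lemma riesz_mult_constraint_nonneg:
  assumes i: "i \<in> {1..p}" and j: "j \<in> {1..m i}" and f: "\<And>x. x \<in> B \<Longrightarrow> 0 \<le> mp_eval f x"
  shows "0 \<le> riesz (y i) (g i j * f)"
proof -
  obtain G where G: "0 < G" "\<And>x. x \<in> B \<Longrightarrow> \<bar>mp_eval (g i j) x\<bar> \<le> G"
    by (rule mp_eval_bounded_on_B[of "g i j"]) blast
  show ?thesis
  proof (rule nonneg_if_nonneg_on_squares[OF compact_B, where K = "G * mass" and T = "\<lambda>f. riesz (y i) (g i j * f)"])
    fix h c assume c: "0 < (c::real)" "\<And>x. x \<in> B \<Longrightarrow> \<bar>mp_eval h x\<bar> \<le> c"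
    have "\<bar>mp_eval (g i j * h) x\<bar> \<le> c * G" if "x \<in> B" for x
      using mult_mono[OF c(2)[OF that] G(2)[OF that]] c(1) by (simp add: abs_mult mult.commute)
    then show "\<bar>riesz (y i) (g i j * h)\<bar> \<le> c * (G * mass)"
      using riesz_bound[OF i, of "c * G" "g i j * h"] c(1) G(1) by (simp add: mult.assoc)
  qed (use riesz_square(3)[OF i j] f in \<open>simp_all add: right_diff_distrib\<close>)
qed

lemma sum_riesz_le_integral:
  assumes f: "\<And>x. x \<in> B \<Longrightarrow> 0 \<le> mp_eval f x"
  shows "(\<Sum>i\<in>{1..p}. riesz (y i) f) \<le> (LINT x|\<mu>. mp_eval f x)"
proof -
  have "0 \<le> riesz (moment \<mu>) f - (\<Sum>i\<in>{1..p}. riesz (y i) f)"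
  proof (rule nonneg_if_nonneg_on_squares[OF compact_B, where K = "mass + real p * mass"
        and T = "\<lambda>f. riesz (moment \<mu>) f - (\<Sum>i\<in>{1..p}. riesz (y i) f)"])
    fix h c assume c: "0 < (c::real)" "\<And>x. x \<in> B \<Longrightarrow> \<bar>mp_eval h x\<bar> \<le> c"
    have "\<bar>\<Sum>i\<in>{1..p}. riesz (y i) h\<bar> \<le> (\<Sum>i\<in>{1..p}. \<bar>riesz (y i) h\<bar>)" by (rule sum_abs)
    also have "\<dots> \<le> (\<Sum>i\<in>{1..p}. c * mass)" by (intro sum_mono riesz_bound c)
    also have "\<dots> = c * (real p * mass)" by (simp add: mult.left_commute)
    finally have 1: "\<bar>\<Sum>i\<in>{1..p}. riesz (y i) h\<bar> \<le> c * (real p * mass)" .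
    have "(LINT x|\<mu>. mp_eval h x) \<le> (LINT x|\<mu>. c)"
      by (rule integral_mono_on_B) (use c in force)+
    moreover have "(LINT x|\<mu>. - c) \<le> (LINT x|\<mu>. mp_eval h x)"
      by (rule integral_mono_on_B) (use c in force)+
    ultimately have "\<bar>riesz (moment \<mu>) h\<bar> \<le> c * mass"
      by (simp add: riesz_moment abs_le_iff mult.commute)
    with 1 show "\<bar>riesz (moment \<mu>) h - (\<Sum>i\<in>{1..p}. riesz (y i) h)\<bar> \<le> c * (mass + real p * mass)"
      by (simp add: distrib_left)
  next
    show "0 \<le> riesz (moment \<mu>) (h * h) - (\<Sum>i\<in>{1..p}. riesz (y i) (h * h))" for h
      using riesz_square(1)[of h] by (simp only: riesz_moment diff_ge_0_iff_ge)
  qed (use f in \<open>simp_all add: sum_subtractf\<close>)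
  then show ?thesis by (simp add: riesz_moment)
qed

text \<open>
  A continuous nonnegative function that vanishes exactly on \<open>\<Omega>\<^sub>i\<close>; the negative parts are squared
  because \<open>- g u = u\<^sup>2\<close> for \<open>u = max 0 (- g)\<close>, which turns it into a combination of the \<open>g\<^sub>i\<^sub>j\<close> with
  nonnegative continuous multipliers.
\<close>

definition violation :: "nat \<Rightarrow> real ^ 'a \<Rightarrow> real"
  where "violation i x = (\<Sum>j\<in>{1..m i}. (max 0 (- mp_eval (g i j) x))\<^sup>2)"

text \<open>
  Cutting the factors off at 1 puts the product below each of them, while it still vanishes exactly
  on the union of the \<open>\<Omega>\<^sub>i\<close>.
\<close>

definition joint_violation :: "real ^ 'a \<Rightarrow> real"
  where "joint_violation x = (\<Prod>i\<in>{1..p}. min 1 (violation i x))"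

lemma violation_nonneg: "0 \<le> violation i x"
  by (simp add: violation_def sum_nonneg)

lemma joint_violation_le: "i \<in> {1..p} \<Longrightarrow> joint_violation x \<le> violation i x"
proof -
  assume i: "i \<in> {1..p}"
  have "joint_violation x = min 1 (violation i x) * (\<Prod>i\<in>{1..p} - {i}. min 1 (violation i x))"
    unfolding joint_violation_def by (rule prod.remove) (use i in auto)
  also have "\<dots> \<le> min 1 (violation i x)"
    using violation_nonneg by (intro mult_left_le prod_le_1) auto
  finally show ?thesis by simp
qed

lemma joint_violation_nonneg: "0 \<le> joint_violation x"
  unfolding joint_violation_def using violation_nonneg by (intro prod_nonneg) auto

lemma joint_violation_eq_0_iff: "joint_violation x = 0 \<longleftrightarrow> x \<in> \<Omega>"
proof -
  have "violation i x = 0 \<longleftrightarrow> x \<in> basic_set m g i" for i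
    unfolding violation_def
    by (subst sum_nonneg_eq_0_iff) (auto simp: basic_set_def max_def)
  moreover have "min 1 (violation i x) = 0 \<longleftrightarrow> violation i x = 0" for i by (auto simp: min_def)
  ultimately show ?thesis
    by (simp add: joint_violation_def Omega_eq)
qed

lemma continuous_on_joint_violation: "continuous_on A joint_violation"
  unfolding joint_violation_def violation_def
  by (intro continuous_intros continuous_on_min continuous_on_max)

text \<open>
  The multiplier \<open>s\<close> approximates \<open>N * max 0 (- g\<^sub>i\<^sub>j)\<close> uniformly on \<open>B\<close> from above, hence is
  nonnegative, and \<open>g\<^sub>i\<^sub>j\<close> times its target is \<open>- N * (max 0 (- g\<^sub>i\<^sub>j))\<^sup>2\<close>.
\<close>

lemma multiplier_exists:
  fixes \<eta> N :: real
  assumes "0 < \<eta>" "0 \<le> N"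
  obtains s :: "'a mpoly" where "\<And>x. x \<in> B \<Longrightarrow> 0 \<le> mp_eval s x"
    "\<And>x. x \<in> B \<Longrightarrow> mp_eval (g i j * s) x \<le> \<eta> - N * (max 0 (- mp_eval (g i j) x))\<^sup>2"
proof -
  let ?u = "\<lambda>x. max 0 (- mp_eval (g i j) x)"
  obtain G where G: "0 < G" "\<And>x. x \<in> B \<Longrightarrow> \<bar>mp_eval (g i j) x\<bar> \<le> G"
    by (rule mp_eval_bounded_on_B[of "g i j"]) blast
  define \<delta> where "\<delta> = \<eta> / (2 * G)"
  have \<delta>: "0 < \<delta>" "G * (2 * \<delta>) = \<eta>" using assms(1) G(1) by (simp_all add: \<delta>_def)
  have "continuous_on B (\<lambda>x. N * ?u x + \<delta>)"
    by (intro continuous_intros continuous_on_max)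
  then obtain s :: "'a mpoly" where s: "\<And>x. x \<in> B \<Longrightarrow> \<bar>N * ?u x + \<delta> - mp_eval s x\<bar> < \<delta>"
    using Stone_Weierstrass_mpoly[OF compact_B _ \<delta>(1)] by blast
  show ?thesis
  proof (rule that[of s])
    fix x assume x: "x \<in> B"
    have "0 \<le> N * ?u x" using assms(2) by simp
    then show "0 \<le> mp_eval s x" using s[OF x] by linarith
    have "mp_eval (g i j) x * ?u x = - (?u x)\<^sup>2"
      by (simp add: max_def power2_eq_square)
    then have "mp_eval (g i j * s) x = mp_eval (g i j) x * (mp_eval s x - N * ?u x) - N * (?u x)\<^sup>2"
      by (simp add: right_diff_distrib mult.left_commute[of _ N])
    moreover have "mp_eval (g i j) x * (mp_eval s x - N * ?u x) \<le> \<bar>mp_eval (g i j) x\<bar> * \<bar>mp_eval s x - N * ?u x\<bar>"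
      by (metis abs_ge_self abs_mult)
    moreover have "\<dots> \<le> G * (2 * \<delta>)"
      using G x s[OF x] by (intro mult_mono) auto
    ultimately show "mp_eval (g i j * s) x \<le> \<eta> - N * (?u x)\<^sup>2"
      using \<delta>(2) by linarith
  qed
qed

text \<open>
  This is weak duality.  Let \<open>w\<close> be a polynomial slightly above the integrand on the right.  On \<open>B\<close>,
  \<open>w - f\<close> exceeds \<open>- N * violation i\<close>, hence also a combination of the \<open>g\<^sub>i\<^sub>j\<close> with polynomial
  multipliers that are nonnegative on \<open>B\<close>; thus \<open>riesz (y i) f \<le> riesz (y i) w\<close> for each \<open>i\<close>.  Since
  \<open>w\<close> is nonnegative on \<open>B\<close>, its values sum to at most the integral of \<open>w\<close>.
\<close>

lemma sum_riesz_le_penalized_integral: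
  fixes N :: real
  assumes "0 \<le> N"
  shows "(\<Sum>i\<in>{1..p}. riesz (y i) f) \<le> (LINT x|\<mu>. max 0 (mp_eval f x - N * joint_violation x))"
proof (rule field_le_epsilon)
  fix e' :: real assume "0 < e'"
  define e where "e = e' / (3 * mass + 1)"
  have "0 < 3 * mass + 1" by (simp add: add_nonneg_pos)
  with \<open>0 < e'\<close> have "0 < e" and e_mult: "e * (3 * mass + 1) = e'"
    by (simp_all add: e_def)
  let ?\<phi> = "\<lambda>x. max 0 (mp_eval f x - N * joint_violation x)"
  have cont: "continuous_on A ?\<phi>" for A
    by (intro continuous_intros continuous_on_max continuous_on_joint_violation)
  have int: "integrable \<mu> ?\<phi>"
  proof -
    have "bounded (?\<phi> ` B)" by (intro compact_imp_bounded compact_continuous_image cont compact_B)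
    then obtain c where "\<And>x. x \<in> B \<Longrightarrow> \<bar>?\<phi> x\<bar> \<le> c" by (auto simp: bounded_iff)
    then show ?thesis
      by (intro integrable_bounded_on_B[of _ c] borel_measurable_continuous_onI cont)
  qed
  have "continuous_on B (\<lambda>x. ?\<phi> x + 2 * e)" by (intro continuous_on_add continuous_on_const cont)
  then obtain w :: "'a mpoly" where w: "\<And>x. x \<in> B \<Longrightarrow> \<bar>?\<phi> x + 2 * e - mp_eval w x\<bar> < e"
    using Stone_Weierstrass_mpoly[OF compact_B _ \<open>0 < e\<close>] by blast
  have "riesz (y i) f \<le> riesz (y i) w" if i: "i \<in> {1..p}" for i
  proof -
    define \<eta> where "\<eta> = e / (real (m i) + 1)"
    have \<eta>: "0 < \<eta>" "real (m i) * \<eta> \<le> e"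
      using \<open>0 < e\<close> by (simp_all add: \<eta>_def field_simps add_pos_nonneg)
    have "\<exists>s :: 'a mpoly. \<forall>x\<in>B. 0 \<le> mp_eval s x \<and>
        mp_eval (g i j * s) x \<le> \<eta> - N * (max 0 (- mp_eval (g i j) x))\<^sup>2" for j
      using multiplier_exists[OF \<eta>(1) assms, of i j] by metis
    then obtain s :: "nat \<Rightarrow> 'a mpoly" where s: "\<And>j x. x \<in> B \<Longrightarrow> 0 \<le> mp_eval (s j) x"
      "\<And>j x. x \<in> B \<Longrightarrow> mp_eval (g i j * s j) x \<le> \<eta> - N * (max 0 (- mp_eval (g i j) x))\<^sup>2"
      by metis
    have "0 \<le> riesz (y i) (w - f - (\<Sum>j\<in>{1..m i}. g i j * s j))"
    proof (rule riesz_nonneg[OF i])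
      fix x assume x: "x \<in> B"
      have "mp_eval (\<Sum>j\<in>{1..m i}. g i j * s j) x
          \<le> (\<Sum>j\<in>{1..m i}. \<eta> - N * (max 0 (- mp_eval (g i j) x))\<^sup>2)"
        unfolding mp_eval_sum by (intro sum_mono s x)
      also have "\<dots> = real (m i) * \<eta> - N * violation i x"
        by (simp add: sum_subtractf violation_def sum_distrib_left)
      also have "\<dots> \<le> e - N * joint_violation x"
        using \<eta>(2) mult_left_mono[OF joint_violation_le[OF i] assms] by (intro diff_mono) auto
      also have "\<dots> \<le> mp_eval w x - mp_eval f x"
        using w[OF x] by linarith
      finally show "0 \<le> mp_eval (w - f - (\<Sum>j\<in>{1..m i}. g i j * s j)) x"
        unfolding mp_eval_diff by linarith
    qed
    moreover have "0 \<le> (\<Sum>j\<in>{1..m i}. riesz (y i) (g i j * s j))"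
      by (intro sum_nonneg riesz_mult_constraint_nonneg i s)
    ultimately show ?thesis by simp
  qed
  then have "(\<Sum>i\<in>{1..p}. riesz (y i) f) \<le> (\<Sum>i\<in>{1..p}. riesz (y i) w)" by (rule sum_mono)
  also have "\<dots> \<le> (LINT x|\<mu>. mp_eval w x)"
  proof (rule sum_riesz_le_integral)
    show "0 \<le> mp_eval w x" if "x \<in> B" for x using w[OF that] \<open>0 < e\<close> by linarith
  qed
  also have "\<dots> \<le> (LINT x|\<mu>. ?\<phi> x + 3 * e)"
  proof (rule integral_mono_on_B)
    show "integrable \<mu> (\<lambda>x. ?\<phi> x + 3 * e)" using int by simp
    show "mp_eval w x \<le> ?\<phi> x + 3 * e" if "x \<in> B" for x using w[OF that] by linarith
  qed simp
  also have "\<dots> = (LINT x|\<mu>. ?\<phi> x) + 3 * e * mass"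
    using int by simp
  also have "3 * e * mass \<le> e'"
    using e_mult \<open>0 < e\<close> by (simp add: distrib_left mult_ac)
  finally show "(\<Sum>i\<in>{1..p}. riesz (y i) f) \<le> (LINT x|\<mu>. ?\<phi> x) + e'" by simp
qed

text \<open>
  Letting the penalty \<open>N\<close> tend to infinity leaves only the integral over \<open>\<Omega>\<close>.
\<close>

lemma sum_riesz_le_integral_Omega:
  "(\<Sum>i\<in>{1..p}. riesz (y i) f) \<le> (LINT x|\<mu>. indicator \<Omega> x * max 0 (mp_eval f x))"
proof -
  let ?\<phi> = "\<lambda>N x. max 0 (mp_eval f x - real N * joint_violation x)"
  have meas [measurable]: "joint_violation \<in> borel_measurable borel"
    by (intro borel_measurable_continuous_onI continuous_on_joint_violation)
  obtain c where c: "0 < c" "\<And>x. x \<in> B \<Longrightarrow> \<bar>mp_eval f x\<bar> \<le> c"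
    by (rule mp_eval_bounded_on_B[of f]) blast
  have "(\<lambda>N. LINT x|\<mu>. ?\<phi> N x) \<longlonglongrightarrow> (LINT x|\<mu>. indicator \<Omega> x * max 0 (mp_eval f x))"
  proof (rule integral_dominated_convergence)
    show "integrable \<mu> (\<lambda>x. c)" by simp
    show "AE x in \<mu>. norm (?\<phi> N x) \<le> c" for N
      using AE_in_B
    proof eventually_elim
      case (elim x)
      have "0 \<le> real N * joint_violation x" using joint_violation_nonneg by simp
      then have "0 \<le> ?\<phi> N x" "?\<phi> N x \<le> c" using c(2)[OF elim] c(1) by auto
      then show ?case by simp
    qed
    show "AE x in \<mu>. (\<lambda>N. ?\<phi> N x) \<longlonglongrightarrow> indicator \<Omega> x * max 0 (mp_eval f x)"
    proof (rule AE_I2)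
      fix x
      show "(\<lambda>N. ?\<phi> N x) \<longlonglongrightarrow> indicator \<Omega> x * max 0 (mp_eval f x)"
      proof (cases "x \<in> \<Omega>")
        case True
        then show ?thesis using joint_violation_eq_0_iff[of x] by simp
      next
        case False
        then have pos: "0 < joint_violation x"
          using joint_violation_eq_0_iff[of x] joint_violation_nonneg[of x] by simp
        obtain N\<^sub>0 :: nat where N0: "mp_eval f x / joint_violation x \<le> real N\<^sub>0"
          using real_arch_simple by blast
        have "\<forall>\<^sub>F N in sequentially. ?\<phi> N x = 0"
          using eventually_ge_at_top[of N\<^sub>0]
        proof eventually_elim
          case (elim N)
          then have "mp_eval f x / joint_violation x \<le> real N" using N0 by linarith
          then have "mp_eval f x \<le> real N * joint_violation x" using pos by (simp add: field_simps)
          then show ?case by simp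
        qed
        then show ?thesis using False tendsto_eventually by simp
      qed
    qed
  qed measurable
  then show ?thesis
    by (rule LIMSEQ_le_const) (intro exI[of _ 0] allI impI sum_riesz_le_penalized_integral, simp)
qed

text \<open>
  Adding a large constant to \<open>f\<close> removes the positive part from the upper bound; the constant
  cancels because the objective is at least \<open>measure \<mu> \<Omega>\<close>.  Equality follows by applying this to
  \<open>- f\<close> as well.
\<close>

lemma sum_riesz_eq_integral_Omega:
  assumes obj: "measure \<mu> \<Omega> \<le> objective p y"
  shows "(\<Sum>i\<in>{1..p}. riesz (y i) f) = (LINT x|\<mu>. indicator \<Omega> x * mp_eval f x)"
proof -
  have le: "(\<Sum>i\<in>{1..p}. riesz (y i) f) \<le> (LINT x|\<mu>. indicator \<Omega> x * mp_eval f x)" for f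
  proof -
    obtain c where c: "0 < c" "\<And>x. x \<in> B \<Longrightarrow> \<bar>mp_eval f x\<bar> \<le> c"
      by (rule mp_eval_bounded_on_B[of f]) blast
    let ?c = "Poly_Mapping.single 0 c :: 'a mpoly"
    have "(\<Sum>i\<in>{1..p}. riesz (y i) f) + c * measure \<mu> \<Omega>
        \<le> (\<Sum>i\<in>{1..p}. riesz (y i) f) + c * objective p y"
      using obj c(1) by simp
    also have "\<dots> = (\<Sum>i\<in>{1..p}. riesz (y i) (f + ?c))"
      by (simp add: sum.distrib objective_def sum_distrib_left)
    also have "\<dots> \<le> (LINT x|\<mu>. indicator \<Omega> x * max 0 (mp_eval (f + ?c) x))"
      by (rule sum_riesz_le_integral_Omega)
    also have "\<dots> = (LINT x|\<mu>. indicator \<Omega> x * mp_eval f x + c * indicator \<Omega> x)"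
    proof (rule Bochner_Integration.integral_cong)
      fix x
      show "indicator \<Omega> x * max 0 (mp_eval (f + ?c) x) = indicator \<Omega> x * mp_eval f x + c * indicator \<Omega> x"
      proof (cases "x \<in> \<Omega>")
        case True
        then have "0 \<le> mp_eval f x + c" using c(2)[of x] Omega_subset by fastforce
        then show ?thesis using True by simp
      qed simp
    qed simp
    also have "\<dots> = (LINT x|\<mu>. indicator \<Omega> x * mp_eval f x) + c * measure \<mu> \<Omega>"
    proof (subst Bochner_Integration.integral_add)
      show "integrable \<mu> (\<lambda>x. c * indicator \<Omega> x)"
        by (intro integrable_mult_right integrable_real_indicator) (auto simp: less_top[symmetric])
    qed auto
    finally show ?thesis by simp
  qed
  have "(LINT x|\<mu>. indicator \<Omega> x * mp_eval (- f) x) = - (LINT x|\<mu>. indicator \<Omega> x * mp_eval f x)"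
    by simp
  with le[of f] le[of "- f"] show ?thesis by (simp add: sum_negf)
qed

end

section \<open>Convergence of the relaxations\<close>

context stokes_setting
begin

text \<open>
  Otherwise some subsequence keeps a positive distance from the claimed limit.  By compactness it has
  a further subsequence converging to a tuple that satisfies the constraints of every order, with
  objective at least \<open>measure \<mu> \<Omega>\<close>; the moments of such a tuple are determined, a contradiction.
\<close>

lemma sum_moments_tendsto:
  assumes C: "\<And>d. d\<^sub>0 \<le> d \<Longrightarrow> stokes_constraints p m g q r (moment \<mu>) d (Y d)"
    and obj: "\<And>d. d\<^sub>0 \<le> d \<Longrightarrow> measure \<mu> \<Omega> \<le> objective p (Y d)"
  shows "(\<lambda>d. \<Sum>i\<in>{1..p}. Y d i \<alpha>) \<longlonglongrightarrow> (LINT x|\<mu>. indicator \<Omega> x * monom_fun \<alpha> x)"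
    (is "?S \<longlonglongrightarrow> ?I")
proof (rule ccontr)
  assume "\<not> ?S \<longlonglongrightarrow> ?I"
  then obtain e where e: "0 < e" "\<And>N. \<exists>d\<ge>N. e \<le> dist (?S d) ?I"
    unfolding lim_sequentially by (meson linorder_not_le)
  have "infinite {d. e \<le> dist (?S d) ?I}"
    unfolding infinite_nat_iff_unbounded_le using e(2) by auto
  then obtain t\<^sub>0 :: "nat \<Rightarrow> nat" where t0: "strict_mono t\<^sub>0" "\<And>n. e \<le> dist (?S (t\<^sub>0 n)) ?I"
    using infinite_enumerate by blast
  \<comment> \<open>The shift ensures that all members of the subsequence have order at least \<open>d\<^sub>0\<close>.\<close>
  define t where "t n = t\<^sub>0 (n + d\<^sub>0)" for n
  have t_ge: "n + d\<^sub>0 \<le> t n" for n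
    unfolding t_def by (rule seq_suble[OF t0(1)])
  have ev_t: "\<forall>\<^sub>F n in sequentially. N \<le> t n" for N
    using eventually_ge_at_top[of N]
  proof eventually_elim
    case (elim n)
    then show ?case using t_ge[of n] by linarith
  qed
  have Ct: "stokes_constraints p m g q r (moment \<mu>) (t n) (Y (t n))" for n
    using t_ge[of n] by (intro C) simp
  obtain k y where k: "strict_mono k"
    and y': "\<And>i \<gamma>. i \<in> {1..p} \<Longrightarrow> \<forall>\<^sub>F n in sequentially. \<gamma> \<in> expos (2 * t n) \<Longrightarrow>
      (\<lambda>n. Y (t (k n)) i \<gamma>) \<longlonglongrightarrow> y i \<gamma>"
    using stokes_constraints_convergent_subsequence[where D = t and Y = "\<lambda>n. Y (t n)", OF Ct] by blast
  have y: "(\<lambda>n. Y (t (k n)) i \<gamma>) \<longlonglongrightarrow> y i \<gamma>" if "i \<in> {1..p}" for i \<gamma>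
  proof (rule y'[OF that])
    show "\<forall>\<^sub>F n in sequentially. \<gamma> \<in> expos (2 * t n)"
      using ev_t[of "expo_size \<gamma>"] by eventually_elim (simp add: expos_def)
  qed
  interpret limit_tuple B \<Omega> \<mu> q r p m g y
  proof
    fix d assume d: "min_order p m g \<le> d"
    have "\<forall>\<^sub>F n in sequentially. stokes_constraints p m g q r (moment \<mu>) d (Y (t (k n)))"
      using eventually_subseq[OF k ev_t[of d]]
      by eventually_elim (rule stokes_constraints_mono[OF Ct])
    then show "stokes_constraints p m g q r (moment \<mu>) d y"
      by (rule stokes_constraints_limit[OF d]) (rule y)
  qed
  have lim: "(\<lambda>n. ?S (t (k n))) \<longlonglongrightarrow> (\<Sum>i\<in>{1..p}. y i \<alpha>)"
    by (intro tendsto_sum y)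
  have "measure \<mu> \<Omega> \<le> objective p y"
  proof (rule LIMSEQ_le_const)
    show "(\<lambda>n. objective p (Y (t (k n)))) \<longlonglongrightarrow> objective p y"
      unfolding objective_def by (intro tendsto_sum y)
    show "\<exists>N. \<forall>n\<ge>N. measure \<mu> \<Omega> \<le> objective p (Y (t (k n)))"
      using obj t_ge by (metis add_leD2)
  qed
  from sum_riesz_eq_integral_Omega[OF this, of "monomial \<alpha>"]
  have "(\<Sum>i\<in>{1..p}. y i \<alpha>) = ?I" by simp
  then have "(\<lambda>n. ?S (t (k n))) \<longlonglongrightarrow> ?I" using lim by metis
  then obtain N where "\<And>n. N \<le> n \<Longrightarrow> dist (?S (t (k n))) ?I < e"
    unfolding lim_sequentially using e(1) by blast
  then have "dist (?S (t (k N))) ?I < e" by blast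
  moreover have "e \<le> dist (?S (t (k N))) ?I" unfolding t_def by (rule t0(2))
  ultimately show False by linarith
qed

end

theorem theorem3p4:
  fixes B \<Omega> :: "(real ^ 'n::finite) set"
    and \<mu> :: "(real ^ 'n) measure"
    and q r :: "'n mpoly"
    and p :: nat
    and m :: "nat \<Rightarrow> nat"
    and g :: "nat \<Rightarrow> nat \<Rightarrow> 'n mpoly"
  assumes "is_box B"
    and "sets \<mu> = sets borel"
    and "finite_measure \<mu>"
    and "measure_support \<mu> = B"
    and "\<mu> = density lborel (\<lambda>x. ennreal (mp_eval q x * exp (mp_eval r x) * indicator B x))"
    and "1 \<le> p"
    and "\<Omega> = (\<Union>i\<in>{1..p}. basic_set m g i)"
    and "\<Omega> \<subseteq> B"
    and "\<Omega> = closure (interior \<Omega>)"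
  shows "(\<forall>d\<ge>min_order p m g. \<exists>y. stokes_optimal p m g q r (moment \<mu>) d y) \<and>
    (\<forall>d\<ge>min_order p m g. \<forall>d'\<ge>d.
       stokes_value p m g q r (moment \<mu>) d' \<le> stokes_value p m g q r (moment \<mu>) d) \<and>
    (\<lambda>d. stokes_value p m g q r (moment \<mu>) d) \<longlonglongrightarrow> ereal (measure \<mu> \<Omega>) \<and>
    (\<forall>Y. (\<forall>d\<ge>min_order p m g. stokes_optimal p m g q r (moment \<mu>) d (Y d)) \<longrightarrow>
       (\<forall>\<alpha>. (\<lambda>d. \<Sum>i\<in>{1..p}. Y d i \<alpha>) \<longlonglongrightarrow> (LINT x:\<Omega>|\<mu>. monom_fun \<alpha> x)))"
proof -
  interpret stokes_setting B \<Omega> \<mu> q r p m g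
    by (intro stokes_setting.intro assms)
  let ?d\<^sub>0 = "min_order p m g"
  have exists: "\<exists>y. stokes_optimal p m g q r (moment \<mu>) d y" if "?d\<^sub>0 \<le> d" for d
    using stokes_optimal_exists[OF that stokes_constraints_pieces] .
  have lower: "ereal (measure \<mu> \<Omega>) \<le> stokes_value p m g q r (moment \<mu>) d" if "?d\<^sub>0 \<le> d" for d
    unfolding stokes_value_def
    using SUP_upper[OF truncate_tuple_feasible[OF that stokes_constraints_pieces], of "\<lambda>y. ereal (objective p y)"]
    by (simp add: objective_pieces)
  have lim: "(\<lambda>d. \<Sum>i\<in>{1..p}. Y d i \<alpha>) \<longlonglongrightarrow> (LINT x|\<mu>. indicator \<Omega> x * monom_fun \<alpha> x)"
    if Y: "\<And>d. ?d\<^sub>0 \<le> d \<Longrightarrow> stokes_optimal p m g q r (moment \<mu>) d (Y d)" for Y \<alpha>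
  proof (rule sum_moments_tendsto)
    fix d assume d: "?d\<^sub>0 \<le> d"
    show "stokes_constraints p m g q r (moment \<mu>) d (Y d)"
      using Y[OF d] by (simp add: stokes_optimal_def stokes_feasible_iff)
    show "measure \<mu> \<Omega> \<le> objective p (Y d)"
      using Y[OF d] lower[OF d] by (metis stokes_optimal_def ereal_less_eq(3))
  qed
  have "(\<lambda>d. stokes_value p m g q r (moment \<mu>) d) \<longlonglongrightarrow> ereal (measure \<mu> \<Omega>)"
  proof -
    obtain Y where Y: "\<And>d. ?d\<^sub>0 \<le> d \<Longrightarrow> stokes_optimal p m g q r (moment \<mu>) d (Y d)"
      using exists by metis
    have "(\<lambda>d. objective p (Y d)) \<longlonglongrightarrow> measure \<mu> \<Omega>"
      using lim[of Y 0] Y sets_eq_imp_space_eq[OF sets_\<mu>] by (simp add: objective_def)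
    then have "(\<lambda>d. ereal (objective p (Y d))) \<longlonglongrightarrow> ereal (measure \<mu> \<Omega>)" by simp
    moreover have "\<forall>\<^sub>F d in sequentially. ereal (objective p (Y d)) = stokes_value p m g q r (moment \<mu>) d"
      using eventually_ge_at_top[of ?d\<^sub>0] by eventually_elim (use Y in \<open>simp add: stokes_optimal_def\<close>)
    ultimately show ?thesis by (rule Lim_transform_eventually)
  qed
  moreover have "(\<lambda>d. \<Sum>i\<in>{1..p}. Y d i \<alpha>) \<longlonglongrightarrow> (LINT x:\<Omega>|\<mu>. monom_fun \<alpha> x)"
    if "\<forall>d\<ge>?d\<^sub>0. stokes_optimal p m g q r (moment \<mu>) d (Y d)" for Y \<alpha>
    using lim[of Y \<alpha>] that by (simp add: set_lebesgue_integral_def)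
  ultimately show ?thesis
    using exists stokes_value_antimono by blast
qed

end
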